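(* Let $k$ be a positive integer. Every complete bipartite simple topological graph with vertex classes $U$ and $V$, where $|U| > 2(k-1)^4$ and $|V| \geq 2^{k^{5k}}$, contains a topological subgraph weakly isomorphic to $C_{k,k}$.
   Context: A topological graph is a (finite) graph drawn in the plane such that its vertices are represented by points and its edges by non-self-intersecting arcs connecting the corresponding points. No edge passes through a point representing a vertex other than its endpoints. Tangencies between edges are not allowed: if two edges share an interior point, they properly cross at this point. A topological graph is simple if every pair of its edges intersect at most once: at a common endpoint or at a proper crossing. A topological graph $H$ is a topological subgraph of $G$ if $V(H)\subset V(G)$ and $E(H)\subset E(G)$ (with the same drawing). Two topological graphs $G$ and $H$ are weakly isomorphic if there is an incidence preserving bijection between the vertices and edges of $G$ and those of $H$ such that two edges of $G$ cross if and only if the corresponding edges of $H$ cross. A complete bipartite simple topological graph with vertex classes $U,V$ is a simple topological graph whose underlying abstract graph is the complete bipartite graph between $U$ and $V$. $C_{s,t}$ denotes the complete bipartite topological graph with straight-line edges whose $s$ vertices of one class lie on the $y$-axis and whose $t$ vertices of the other class lie on the vertical line $x=1$, with all $st$ straight-line segments between the classes drawn as edges (up to weak isomorphism this does not depend on the exact placement of the vertices on these lines). *)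

theory Defs
  imports "HOL-Analysis.Analysis"
begin

text \<open>
  The plane is \<^typ>\<open>complex\<close>. An edge is identified with the point set of the arc that draws it;
  the endpoints are determined by this point set, and two distinct edges of a topological graph
  never have the same point set because they would not cross properly at their common interior
  points. Parallel edges are not excluded by the type.
\<close>

record tgraph =
  verts :: "complex set"
  edges :: "complex set set"

definition arc_joins :: "complex set \<Rightarrow> complex \<Rightarrow> complex \<Rightarrow> bool" where
  "arc_joins e x y \<longleftrightarrow>
     (\<exists>g. arc g \<and> path_image g = e \<and> pathstart g = x \<and> pathfinish g = y)"

definition arc_ends :: "complex set \<Rightarrow> complex set" where
  "arc_ends e = {x. \<exists>y. arc_joins e x y}"

definition arc_interior :: "complex set \<Rightarrow> complex set" where
  "arc_interior e = e - arc_ends e"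

text \<open>
  A proper crossing: in suitable local coordinates around the point, the two arcs are the two
  coordinate axes. This rules out tangencies and overlaps.
\<close>

definition properly_cross_at :: "complex set \<Rightarrow> complex set \<Rightarrow> complex \<Rightarrow> bool" where
  "properly_cross_at e f p \<longleftrightarrow>
     p \<in> arc_interior e \<and> p \<in> arc_interior f \<and>
     (\<exists>S h h'. open S \<and> p \<in> S \<and> homeomorphism S (ball 0 1) h h' \<and> h p = 0 \<and>
        h ` (S \<inter> e) = {z \<in> ball 0 1. Im z = 0} \<and>
        h ` (S \<inter> f) = {z \<in> ball 0 1. Re z = 0})"

definition crosses :: "complex set \<Rightarrow> complex set \<Rightarrow> bool" where
  "crosses e f \<longleftrightarrow> (\<exists>p. properly_cross_at e f p)"

definition topological_graph :: "tgraph \<Rightarrow> bool" where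
  "topological_graph G \<longleftrightarrow>
     finite (verts G) \<and> finite (edges G) \<and>
     (\<forall>e\<in>edges G. \<exists>x\<in>verts G. \<exists>y\<in>verts G. arc_joins e x y \<and> e \<inter> verts G = {x, y}) \<and>
     (\<forall>e\<in>edges G. \<forall>f\<in>edges G. e \<noteq> f \<longrightarrow>
        (\<forall>p \<in> arc_interior e \<inter> arc_interior f. properly_cross_at e f p))"

text \<open>
  In a topological graph a common point of two edges is either a common endpoint or a common
  interior point, hence a proper crossing; so simplicity only has to bound the number of common
  points.
\<close>

definition simple_topological_graph :: "tgraph \<Rightarrow> bool" where
  "simple_topological_graph G \<longleftrightarrow>
     topological_graph G \<and>
     (\<forall>e\<in>edges G. \<forall>f\<in>edges G. e \<noteq> f \<longrightarrow> (\<exists>p. e \<inter> f \<subseteq> {p}))"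

definition topological_subgraph :: "tgraph \<Rightarrow> tgraph \<Rightarrow> bool" where
  "topological_subgraph H G \<longleftrightarrow>
     topological_graph H \<and> verts H \<subseteq> verts G \<and> edges H \<subseteq> edges G"

definition weakly_isomorphic :: "tgraph \<Rightarrow> tgraph \<Rightarrow> bool" where
  "weakly_isomorphic G H \<longleftrightarrow>
     (\<exists>\<phi> \<psi>. bij_betw \<phi> (verts G) (verts H) \<and> bij_betw \<psi> (edges G) (edges H) \<and>
        (\<forall>v\<in>verts G. \<forall>e\<in>edges G. v \<in> arc_ends e \<longleftrightarrow> \<phi> v \<in> arc_ends (\<psi> e)) \<and>
        (\<forall>e\<in>edges G. \<forall>f\<in>edges G. crosses e f \<longleftrightarrow> crosses (\<psi> e) (\<psi> f)))"

definition complete_bipartite_simple_tgraph ::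
    "tgraph \<Rightarrow> complex set \<Rightarrow> complex set \<Rightarrow> bool" where
  "complete_bipartite_simple_tgraph G U V \<longleftrightarrow>
     simple_topological_graph G \<and> verts G = U \<union> V \<and> U \<inter> V = {} \<and>
     bij_betw arc_ends (edges G) {{u, v} | u v. u \<in> U \<and> v \<in> V}"

text \<open>
  The graph $C_{s,t}$, with its vertices placed at heights $0, 1, 2, \ldots$ on the two lines. Up
  to weak isomorphism the heights are irrelevant: two edges cross iff the order of their ends on
  the line $x = 0$ is opposite to the order of their ends on the line $x = 1$.
\<close>

definition C_graph :: "nat \<Rightarrow> nat \<Rightarrow> tgraph" where
  "C_graph s t =
     \<lparr>verts = {Complex 0 (real i) | i. i < s} \<union> {Complex 1 (real j) | j. j < t},
      edges = {closed_segment (Complex 0 (real i)) (Complex 1 (real j)) | i j. i < s \<and> j < t}\<rparr>"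

end

theory Submission
  imports Defs
begin

text \<open>
  The copy of \<open>C\<^sub>k\<^sub>,\<^sub>k\<close> is found by Ramsey's theorem for pairs of vertices in \<open>V\<close>, and the geometry enters
  through three facts about simple drawings of small complete bipartite graphs.

  First, in a 4-cycle at most one of the two pairs of opposite edges crosses
  (\<open>four_cycle_one_crossing\<close>). For fixed \<open>v\<close>, \<open>v'\<close> in \<open>V\<close>, this orients the crossing pairs in \<open>U\<close>: write
  \<open>u \<rightarrow> w\<close> if \<open>uv\<close> crosses \<open>wv'\<close>. Second, this orientation has no cyclic triangle
  (\<open>no_cyclic_crossings\<close>), so it orders every set of pairwise related vertices linearly. Third, a drawing
  of \<open>K\<^sub>3\<^sub>,\<^sub>3\<close> has a crossing (\<open>K33_has_crossing\<close>).

  Since \<open>U\<close> has at least \<open>k\<^sup>2\<close> vertices when \<open>k \<ge> 3\<close>, the bound for the Ramsey number \<open>R(3,k)\<close> gives, for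
  each pair \<open>v\<close>, \<open>v'\<close>, either \<open>k\<close> pairwise related vertices in \<open>U\<close>, listed in their linear order,
  or three pairwise unrelated ones. Taking this list or triple as the colour of the pair, with
  all colours drawn from \<open>k\<^sup>2\<close> vertices of \<open>U\<close>, there are at most \<open>2 k ^ (2k)\<close> colours, so \<open>V\<close> is
  large enough for a set of \<open>k\<close> vertices all of whose pairs have the same colour. This colour is not a
  triple, because \<open>K\<^sub>3\<^sub>,\<^sub>3\<close> has a crossing; hence it is a list of \<open>k\<close> vertices which together with the
  \<open>k\<close> vertices in \<open>V\<close> has all crossings of \<open>C\<^sub>k\<^sub>,\<^sub>k\<close> (\<open>ordered_crossing_lists\<close>). It has no further ones,
  again by the first fact.

  The case \<open>k = 2\<close> asks for a single crossing and is the third fact itself.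

  The first two facts come from one parity argument (\<open>triangle_parity\<close>) on a Jordan curve composed of
  an edge and initial pieces of two crossing edges: an arc that crosses the curve once changes
  sides (\<open>crossing_separates\<close>), and the two arcs that leave the curve at its crossing corner are on the
  same side (\<open>corner_same_side\<close>). The third fact follows from Janiszewski's theorem
  (\<open>theta_no_point_reaches_all_arcs\<close>).
\<close>

section \<open>Arcs and Jordan curves\<close>

lemma arc_joinsE:
  assumes "arc_joins e x y"
  obtains g where "arc g" "path_image g = e" "g 0 = x" "g 1 = y"
  using assms by (auto simp: arc_joins_def pathstart_def pathfinish_def)

lemma arc_joins_sym: "arc_joins e x y \<Longrightarrow> arc_joins e y x"
  unfolding arc_joins_def
  by (metis arc_reversepath path_image_reversepath pathfinish_reversepath pathstart_reversepath)

lemma arc_joins_properties: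
  assumes "arc_joins e x y"
  shows "x \<in> e" "y \<in> e" "x \<noteq> y" "compact e" "closed e" "connected e"
proof -
  obtain g where g: "arc g" "path_image g = e" "pathstart g = x" "pathfinish g = y"
    using assms by (auto simp: arc_joins_def)
  show "x \<in> e" "y \<in> e" "x \<noteq> y" "compact e" "closed e" "connected e"
    using g arc_distinct_ends[of g] compact_arc_image[of g] closed_arc_image[of g]
      connected_arc_image[of g] by auto
qed

lemma connected_arc_minus_end:
  assumes "arc_joins e x y"
  shows "connected (e - {x})" "connected (e - {y})"
proof -
  have *: "connected (e - {x})" if e: "arc_joins e x y" for x y
  proof -
    obtain g where g: "arc g" "path_image g = e" "g 0 = x" "g 1 = y"
      using arc_joinsE[OF e] .
    have "e - {x} = g ` {0<..1}"
      using g by (force simp: path_image_def arc_def inj_on_def less_le)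
    moreover have "connected (g ` {0<..1})"
      by (rule connected_continuous_image)
        (use g in \<open>auto simp: arc_def path_def intro: continuous_on_subset\<close>)
    ultimately show ?thesis by simp
  qed
  show "connected (e - {x})" "connected (e - {y})"
    using *[OF assms] *[OF arc_joins_sym[OF assms]] by auto
qed

lemma connected_arc_minus_ends:
  assumes "arc_joins e x y"
  shows "connected (e - {x, y})"
proof -
  obtain g where g: "arc g" "path_image g = e" "pathstart g = x" "pathfinish g = y"
    using assms by (auto simp: arc_joins_def)
  then show ?thesis
    using connected_simple_path_endless[of g] arc_imp_simple_path[of g] by simp
qed

lemma arc_joins_split:
  assumes e: "arc_joins e x y" and p: "p \<in> e" "p \<noteq> x" "p \<noteq> y"
  obtains e1 e2 where "arc_joins e1 x p" "arc_joins e2 p y" "e1 \<union> e2 = e" "e1 \<inter> e2 = {p}"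
    "y \<notin> e1" "x \<notin> e2"
proof -
  obtain g where g: "arc g" "path_image g = e" "g 0 = x" "g 1 = y"
    using arc_joinsE[OF e] .
  obtain t where t: "t \<in> {0..1}" "g t = p"
    using p g by (auto simp: path_image_def)
  have t01: "0 < t" "t < 1" using t g p by (auto simp: less_le)
  have inj: "inj_on g {0..1}" using g by (simp add: arc_def)
  have "arc_joins (g ` {0..t}) x p"
    unfolding arc_joins_def using g t t01
    by (intro exI[of _ "subpath 0 t g"]) (auto simp: path_image_subpath arc_subpath_arc)
  moreover have "arc_joins (g ` {t..1}) p y"
    unfolding arc_joins_def using g t t01
    by (intro exI[of _ "subpath t 1 g"]) (auto simp: path_image_subpath arc_subpath_arc)
  moreover have "g ` {0..t} \<union> g ` {t..1} = e"
    using g t01 by (auto simp: path_image_def image_Un[symmetric] ivl_disj_un_two_touch)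
  moreover have int: "g ` {0..t} \<inter> g ` {t..1} = {p}"
  proof -
    have "g ` {0..t} \<inter> g ` {t..1} = g ` ({0..t} \<inter> {t..1})"
      by (rule inj_on_image_Int[OF inj, symmetric]) (use t01 in auto)
    also have "{0..t} \<inter> {t..1} = {t}" using t01 by auto
    finally show ?thesis using t by simp
  qed
  moreover have "x \<in> g ` {0..t}" "y \<in> g ` {t..1}" using g t01 by force+
  then have "y \<notin> g ` {0..t}" "x \<notin> g ` {t..1}" using int p by auto
  ultimately show thesis using that by blast
qed

lemma arc_joins_Un:
  assumes "arc_joins c x y" "arc_joins d y z" "c \<inter> d = {y}"
  shows "arc_joins (c \<union> d) x z"
proof -
  obtain g where g: "arc g" "path_image g = c" "pathstart g = x" "pathfinish g = y"
    using assms(1) by (auto simp: arc_joins_def)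
  obtain h where h: "arc h" "path_image h = d" "pathstart h = y" "pathfinish h = z"
    using assms(2) by (auto simp: arc_joins_def)
  show ?thesis
    unfolding arc_joins_def
    by (intro exI[of _ "g +++ h"]) (use g h assms(3) in \<open>auto simp: path_image_join intro!: arc_join\<close>)
qed

text \<open>
  Removing a point from an arc leaves a connected set only if the point is an end of the arc, and
  this characterisation does not mention a parametrization.
\<close>

lemma arc_ends_eq:
  assumes "arc_joins e a b"
  shows "arc_ends e = {a, b}"
proof (intro subset_antisym subsetI)
  fix x assume "x \<in> arc_ends e"
  then obtain y where y: "arc_joins e x y" by (auto simp: arc_ends_def)
  show "x \<in> {a, b}"
  proof (rule ccontr)
    assume "x \<notin> {a, b}"
    then obtain e1 e2 where e12: "arc_joins e1 a x" "arc_joins e2 x b" "e1 \<union> e2 = e" "e1 \<inter> e2 = {x}"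
      using arc_joins_split[OF assms, of x] arc_joins_properties(1)[OF y] by (metis insert_iff)
    have "e1 \<inter> e2 \<inter> (e - {x}) = {}" "e - {x} \<subseteq> e1 \<union> e2" using e12(3,4) by auto
    then have "e1 \<inter> (e - {x}) = {} \<or> e2 \<inter> (e - {x}) = {}"
      using connected_closedD[OF connected_arc_minus_end(1)[OF y]]
        arc_joins_properties(5)[OF e12(1)] arc_joins_properties(5)[OF e12(2)] by blast
    moreover have "a \<in> e1 \<inter> (e - {x})" "b \<in> e2 \<inter> (e - {x})"
      using arc_joins_properties[OF e12(1)] arc_joins_properties[OF e12(2)] e12(3) by auto
    ultimately show False by blast
  qed
next
  fix x assume "x \<in> {a, b}"
  then show "x \<in> arc_ends e" using assms arc_joins_sym[OF assms] by (auto simp: arc_ends_def)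
qed

definition jordan_curve :: "complex set \<Rightarrow> bool" where
  "jordan_curve J \<longleftrightarrow> (\<exists>c. simple_path c \<and> pathfinish c = pathstart c \<and> path_image c = J)"

lemma jordan_curve_two_arcs:
  assumes "arc_joins c x y" "arc_joins d y x" "c \<inter> d = {x, y}"
  shows "jordan_curve (c \<union> d)"
proof -
  obtain g where g: "arc g" "path_image g = c" "pathstart g = x" "pathfinish g = y"
    using assms(1) by (auto simp: arc_joins_def)
  obtain h where h: "arc h" "path_image h = d" "pathstart h = y" "pathfinish h = x"
    using assms(2) by (auto simp: arc_joins_def)
  show ?thesis
    unfolding jordan_curve_def
    by (intro exI[of _ "g +++ h"])
      (use g h assms(3) in \<open>auto simp: path_image_join intro!: simple_path_join_loop\<close>)
qed

lemma jordan_curve_sides: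
  assumes "jordan_curve J"
  obtains A B where "A \<noteq> {}" "B \<noteq> {}" "open A" "open B" "connected A" "connected B" "A \<inter> B = {}"
    "A \<union> B = - J" "frontier A = J" "frontier B = J"
  using assms Jordan_curve unfolding jordan_curve_def by metis

section \<open>Proper crossings in local coordinates\<close>

text \<open>
  Shrinking the chart of a crossing to a small ball around the origin and rescaling that ball to
  the unit ball gives a chart that avoids all other parts of a drawing which stay away from \<open>p\<close>.
\<close>

lemma properly_cross_at_chart:
  assumes "properly_cross_at e f p" "open W" "p \<in> W"
  obtains S k h where "open S" "p \<in> S" "S \<subseteq> W" "homeomorphism (ball 0 1) S k h" "k 0 = p"
    "S \<inter> e = k ` {z \<in> ball 0 1. Im z = 0}" "S \<inter> f = k ` {z \<in> ball 0 1. Re z = 0}"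
proof -
  obtain S h h' where S: "open S" "p \<in> S" and hom: "homeomorphism S (ball 0 1) h h'" and "h p = 0"
    and e: "h ` (S \<inter> e) = {z \<in> ball 0 1. Im z = 0}" and f: "h ` (S \<inter> f) = {z \<in> ball 0 1. Re z = 0}"
    using assms unfolding properly_cross_at_def by auto
  have hS: "h ` S = ball 0 1" "h' ` ball 0 1 = S" "\<And>x. x \<in> S \<Longrightarrow> h' (h x) = x"
    "\<And>z. z \<in> ball 0 1 \<Longrightarrow> h (h' z) = z" "continuous_on S h" "continuous_on (ball 0 1) h'"
    using hom by (auto simp: homeomorphism_def)
  have h'0: "h' 0 = p" using hS(3)[OF S(2)] \<open>h p = 0\<close> by simp
  have "open (ball 0 1 \<inter> h' -` W)"
    using continuous_open_preimage[OF hS(6) open_ball assms(2)] .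
  moreover have "0 \<in> ball 0 1 \<inter> h' -` W" using assms(3) h'0 by simp
  ultimately obtain r where r: "r > 0" "ball 0 r \<subseteq> ball 0 1 \<inter> h' -` W"
    by (meson open_contains_ball)
  have r1: "ball (0::complex) r \<subseteq> ball 0 1" using r by auto
  define k where "k = (\<lambda>z. h' (of_real r * z))"
  define l where "l = (\<lambda>x. h x / of_real r)"
  define T where "T = h' ` ball 0 r"
  have scale: "(\<lambda>z. of_real r * z) ` {z \<in> ball 0 1. P z} = {z \<in> ball 0 r. P (z / of_real r)}" for P :: "complex \<Rightarrow> bool"
  proof (intro subset_antisym subsetI)
    fix z assume z: "z \<in> {z \<in> ball 0 r. P (z / of_real r)}"
    then have "z = of_real r * (z / of_real r)" "z / of_real r \<in> {z \<in> ball 0 1. P z}"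
      using r(1) by (auto simp: norm_divide)
    then show "z \<in> (\<lambda>z. of_real r * z) ` {z \<in> ball 0 1. P z}" by blast
  qed (use r(1) in \<open>auto simp: norm_mult\<close>)
  have kim: "k ` {z \<in> ball 0 1. P z} = h' ` {z \<in> ball 0 r. P (z / of_real r)}" for P
  proof -
    have "k ` {z \<in> ball 0 1. P z} = h' ` (\<lambda>z. of_real r * z) ` {z \<in> ball 0 1. P z}"
      by (simp add: k_def image_image)
    then show ?thesis by (simp only: scale)
  qed
  have T_alt: "T = S \<inter> h -` ball 0 r"
  proof (intro subset_antisym subsetI)
    fix x assume "x \<in> T"
    then obtain z where "z \<in> ball 0 r" "x = h' z" by (auto simp: T_def)
    then show "x \<in> S \<inter> h -` ball 0 r" using hS(2,4) r1 by auto
  next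
    fix x assume "x \<in> S \<inter> h -` ball 0 r"
    then show "x \<in> T" unfolding T_def by (intro image_eqI[of _ _ "h x"]) (auto simp: hS(3))
  qed
  have "open T" unfolding T_alt by (rule continuous_open_preimage[OF hS(5) S(1) open_ball])
  moreover have "p \<in> T" unfolding T_def using h'0 r(1) by (force intro: image_eqI[of _ _ 0])
  moreover have "T \<subseteq> W" unfolding T_def using r by auto
  moreover have "homeomorphism (ball 0 1) T k l"
  proof (rule homeomorphismI)
    have r_mult: "of_real r * z \<in> ball 0 r" if "z \<in> ball 0 1" for z :: complex
      using that r(1) by (simp add: norm_mult)
    then have "(*) (of_real r) ` ball 0 1 \<subseteq> ball (0::complex) 1" using r1 by blast
    then have "continuous_on (ball 0 1) (h' \<circ> (\<lambda>z. of_real r * z))"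
      by (intro continuous_on_compose continuous_intros continuous_on_subset[OF hS(6)])
    then show "continuous_on (ball 0 1) k" by (simp add: k_def o_def)
    show "continuous_on T l" unfolding l_def
      by (intro continuous_intros continuous_on_subset[OF hS(5)]) (use r T_alt in auto)
    show "k ` ball 0 1 \<subseteq> T" using r_mult by (auto simp: T_def k_def)
    show "l ` T \<subseteq> ball 0 1"
      using r(1) by (auto simp: l_def T_alt norm_divide)
    show "l (k x) = x" if "x \<in> ball 0 1" for x
    proof -
      show ?thesis using r_mult[OF that] r1 r(1) unfolding l_def k_def by (subst hS(4)) auto
    qed
    show "k (l y) = y" if "y \<in> T" for y
      using that r(1) hS(3) by (simp add: l_def k_def T_alt)
  qed
  moreover have "k 0 = p" by (simp add: k_def h'0)
  moreover have "T \<inter> g = k ` {z \<in> ball 0 1. P z}"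
    if g: "h ` (S \<inter> g) = {z \<in> ball 0 1. P z}" and P: "\<And>z. P (z / of_real r) \<longleftrightarrow> P z" for g P
  proof -
    have "T \<inter> g = h' ` {z \<in> ball 0 r. P z}"
    proof (intro subset_antisym subsetI)
      fix x assume x: "x \<in> T \<inter> g"
      then have "x = h' (h x)" "h x \<in> ball 0 r" "P (h x)"
        using hS(3) T_alt g by (auto simp: set_eq_iff)
      then show "x \<in> h' ` {z \<in> ball 0 r. P z}" by blast
    next
      fix x assume "x \<in> h' ` {z \<in> ball 0 r. P z}"
      then obtain z where z: "z \<in> ball 0 r" "P z" "x = h' z" by auto
      with r1 have "z \<in> h ` (S \<inter> g)" using g by auto
      then obtain y where "y \<in> S \<inter> g" "z = h y" by auto
      moreover from this have "h' z = y" using hS(3) by simp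
      ultimately show "x \<in> T \<inter> g"
        using z by (auto simp: T_def intro!: image_eqI[of _ _ "h y"])
    qed
    then show ?thesis using kim[of P] P by simp
  qed
  from this[OF e] this[OF f] have "T \<inter> e = k ` {z \<in> ball 0 1. Im z = 0}"
    "T \<inter> f = k ` {z \<in> ball 0 1. Re z = 0}" using r(1) by auto
  ultimately show thesis using that by blast
qed

text \<open>
  Each of the two local half branches at \<open>p\<close> is connected and avoids \<open>p\<close>, so it lies within one of
  the closed pieces \<open>e1\<close>, \<open>e2\<close>. Both cannot lie in the same piece, because \<open>p\<close> is a limit point of
  each piece. The sign \<open>s\<close> records which half branch belongs to \<open>e1\<close>.
\<close>

lemma arc_pieces_leave_on_opposite_sides:
  assumes e1: "arc_joins e1 x p" and e2: "arc_joins e2 p y" and e12: "e1 \<inter> e2 = {p}"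
    and S: "open S" "p \<in> S" and k: "continuous_on {-1<..<1} k" "inj_on k {-1<..<1}" "k (0::real) = p"
    and im: "S \<inter> (e1 \<union> e2) = k ` {-1<..<1}"
  obtains s :: real where "s = 1 \<or> s = -1"
    "\<And>t. \<lbrakk>0 < t; t < 1\<rbrakk> \<Longrightarrow> k (s * t) \<in> e1 - e2 \<and> k (- s * t) \<in> e2 - e1"
proof -
  have half: "k ` I \<subseteq> e1 - e2 \<or> k ` I \<subseteq> e2 - e1"
    if I: "connected I" "I \<subseteq> {-1<..<1}" "0 \<notin> I" for I
  proof -
    have con: "connected (k ` I)"
      using I k(1) by (meson connected_continuous_image continuous_on_subset)
    have sub: "k ` I \<subseteq> e1 \<union> e2" using I(2) im by blast
    have "p \<notin> k ` I"
    proof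
      assume "p \<in> k ` I"
      then obtain t where "t \<in> I" "k t = k 0" using k(3) by auto
      moreover from this have "t = 0" using inj_onD[OF k(2), of t 0] I(2) by auto
      ultimately show False using I(3) by simp
    qed
    then have disj: "e1 \<inter> e2 \<inter> k ` I = {}" using e12 by auto
    have "e1 \<inter> k ` I = {} \<or> e2 \<inter> k ` I = {}"
      using connected_closedD[OF con disj sub] arc_joins_properties(5)[OF e1]
        arc_joins_properties(5)[OF e2] by blast
    then show ?thesis using sub disj by blast
  qed
  have near: "\<exists>t. t \<in> {-1<..<1} - {0} \<and> k t \<in> e"
    if e: "arc_joins e a b" "p \<in> e" "e \<subseteq> e1 \<union> e2" for e a b
  proof -
    have "p islimpt e"
      using arc_joins_properties[OF e(1)] e(2) by (intro connected_imp_perfect) auto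
    then obtain q where "q \<in> e" "q \<in> S" "q \<noteq> p"
      using S by (meson islimpt_def)
    then have "q \<in> k ` {-1<..<1}" using im e(3) by blast
    then obtain t where t: "t \<in> {-1<..<1}" "q = k t" by auto
    have "t \<noteq> 0" using t(2) \<open>q \<noteq> p\<close> k(3) by auto
    then show ?thesis using t \<open>q \<in> e\<close> by auto
  qed
  have p: "p \<in> e1" "p \<in> e2" using e12 by auto
  obtain t1 where t1: "t1 \<in> {-1<..<1} - {0}" "k t1 \<in> e1" using near[OF e1] p by auto
  obtain t2 where t2: "t2 \<in> {-1<..<1} - {0}" "k t2 \<in> e2" using near[OF e2] p by auto
  have pos: "k ` {0<..<1} \<subseteq> e1 - e2 \<or> k ` {0<..<1} \<subseteq> e2 - e1" by (rule half) auto
  have neg: "k ` {-1<..<0} \<subseteq> e1 - e2 \<or> k ` {-1<..<0} \<subseteq> e2 - e1" by (rule half) auto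
  have t: "t \<in> {0<..<1} \<or> t \<in> {-1<..<0}" if "t \<in> {-1<..<1} - {0}" for t :: real
    using that by auto
  consider "k ` {0<..<1} \<subseteq> e1 - e2" "k ` {-1<..<0} \<subseteq> e2 - e1"
    | "k ` {0<..<1} \<subseteq> e2 - e1" "k ` {-1<..<0} \<subseteq> e1 - e2"
    using pos neg t[OF t1(1)] t[OF t2(1)] t1(2) t2(2) by blast
  then show thesis
  proof cases
    case 1
    show thesis
      by (rule that[of 1]) (use 1 in \<open>auto simp: image_subset_iff\<close>)
  next
    case 2
    show thesis
      by (rule that[of "-1"]) (use 2 in \<open>auto simp: image_subset_iff\<close>)
  qed
qed

text \<open>
  The unit complex number \<open>u\<close> selects one of the two coordinate axes of the chart, so that both
  branches of a crossing are covered.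
\<close>

lemma arc_pieces_on_chart_axis:
  fixes u :: complex
  assumes "homeomorphism (ball 0 1) S k h" "open S" "k 0 = p" "norm u = 1"
    and e1: "arc_joins e1 x p" and e2: "arc_joins e2 p y" and e12: "e1 \<inter> e2 = {p}"
    and im: "S \<inter> (e1 \<union> e2) = k ` (\<lambda>t. u * of_real t) ` {-1<..<1}"
  obtains s :: real where "s = 1 \<or> s = -1"
    "\<And>t. \<lbrakk>0 < t; t < 1\<rbrakk> \<Longrightarrow> k (u * of_real (s * t)) \<in> e1 - e2 \<and> k (u * of_real (- s * t)) \<in> e2 - e1"
proof -
  let ?k = "\<lambda>t::real. k (u * of_real t)"
  have kS: "k ` ball 0 1 = S" and kcont: "continuous_on (ball 0 1) k"
    and hk: "\<And>z. z \<in> ball 0 1 \<Longrightarrow> h (k z) = z"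
    using assms(1) by (auto simp: homeomorphism_def)
  have in_ball: "u * of_real t \<in> ball 0 1" if "t \<in> {-1<..<1}" for t :: real
    using that assms(4) by (auto simp: norm_mult)
  have k1: "continuous_on {-1<..<1} ?k"
    by (rule continuous_on_compose2[OF kcont]) (use in_ball in \<open>auto intro!: continuous_intros\<close>)
  have k2: "inj_on ?k {-1<..<1}"
  proof (rule inj_onI)
    fix s t :: real assume "s \<in> {-1<..<1}" "t \<in> {-1<..<1}" "?k s = ?k t"
    then have "u * of_real s = u * of_real t" using hk in_ball by metis
    then show "s = t" using assms(4) by auto
  qed
  have k3: "?k 0 = p" using assms(3) by simp
  have k4: "S \<inter> (e1 \<union> e2) = ?k ` {-1<..<1}" using im by (simp add: image_image)
  have "k 0 \<in> S" using kS by fastforce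
  then have pS: "p \<in> S" using assms(3) by simp
  show thesis
    using arc_pieces_leave_on_opposite_sides[OF e1 e2 e12 assms(2) pS k1 k2 k3 k4] that by metis
qed

lemma ball_axes:
  "{z \<in> ball 0 1. Im z = 0} = (\<lambda>t. 1 * of_real t) ` {-1<..<1}"
  "{z \<in> ball 0 1. Re z = 0} = (\<lambda>t. \<i> * of_real t) ` {-1<..<1}"
  by (auto simp: image_iff complex_eq_iff cmod_eq_Re cmod_eq_Im intro!: bexI[of _ "Re _"] bexI[of _ "Im _"])

lemma not_properly_cross_self: "\<not> properly_cross_at e e p"
proof
  assume "properly_cross_at e e p"
  then have eq: "{z \<in> ball 0 1. Im z = 0} = {z \<in> ball 0 1. Re z = 0}"
    unfolding properly_cross_at_def by auto
  have "complex_of_real (1/2) \<in> {z \<in> ball 0 1. Im z = 0}" by simp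
  then have "complex_of_real (1/2) \<in> {z \<in> ball 0 1. Re z = 0}" by (simp only: eq)
  then show False by simp
qed

lemma connected_subset_side:
  assumes "open A" "open B" "A \<inter> B = {}" "connected C" "C \<subseteq> A \<union> B"
  shows "C \<subseteq> A \<or> C \<subseteq> B"
  using connectedD[OF assms(4,1,2)] assms(3,5) by blast

text \<open>
  Near \<open>p\<close> the curve \<open>J\<close> is the real axis of a chart, and its complement there consists of an upper
  and a lower half ball. Both sides of \<open>J\<close> have \<open>p\<close> on their frontier, so each of them must contain
  one of the half balls. The two pieces of \<open>f\<close> leave \<open>p\<close> into different half balls and never meet \<open>J\<close>
  again.
\<close>

lemma crossing_separates:
  assumes J: "jordan_curve J" and cross: "properly_cross_at e f p"
    and W: "open W" "p \<in> W" "W \<inter> J = W \<inter> e"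
    and f: "arc_joins f a b" and fJ: "f \<inter> J = {p}"
  shows "\<not> connected_component (- J) a b"
proof
  assume "connected_component (- J) a b"
  then obtain C where C: "connected C" "C \<subseteq> - J" "a \<in> C" "b \<in> C"
    by (auto simp: connected_component_def)
  obtain A B where AB: "A \<noteq> {}" "B \<noteq> {}" "open A" "open B" "connected A" "connected B" "A \<inter> B = {}"
    "A \<union> B = - J" "frontier A = J" "frontier B = J"
    using jordan_curve_sides[OF J] .
  have side: "D \<subseteq> A \<or> D \<subseteq> B" if "connected D" "D \<inter> J = {}" for D
    by (rule connected_subset_side[OF AB(3,4,7) that(1)]) (unfold AB(8), use that(2) in blast)
  obtain S k h where S: "open S" "p \<in> S" "S \<subseteq> W" and hom: "homeomorphism (ball 0 1) S k h"
    and k0: "k 0 = p" and Se: "S \<inter> e = k ` {z \<in> ball 0 1. Im z = 0}"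
    and Sf: "S \<inter> f = k ` {z \<in> ball 0 1. Re z = 0}"
    using properly_cross_at_chart[OF cross W(1,2)] .
  have kS: "k ` ball 0 1 = S" and kcont: "continuous_on (ball 0 1) k" and hk: "\<And>z. z \<in> ball 0 1 \<Longrightarrow> h (k z) = z"
    using hom by (auto simp: homeomorphism_def)
  have SJ: "S \<inter> J = k ` {z \<in> ball 0 1. Im z = 0}"
    using Se W(3) S(3) by blast
  define U L where "U = k ` {z \<in> ball 0 1. Im z > 0}" and "L = k ` {z \<in> ball 0 1. Im z < 0}"
  have offJ: "k z \<in> J \<longleftrightarrow> Im z = 0" if "z \<in> ball 0 1" for z
  proof
    assume "k z \<in> J"
    then have "k z \<in> S \<inter> J" using kS that by blast
    then obtain w where "w \<in> ball 0 1" "Im w = 0" "k z = k w" unfolding SJ by blast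
    then show "Im z = 0" using hk[of w] hk[OF that] by simp
  next
    assume "Im z = 0"
    then have "k z \<in> S \<inter> J" unfolding SJ using that by blast
    then show "k z \<in> J" by blast
  qed
  have conv: "convex {z \<in> ball 0 1. Im z > 0}" "convex {z \<in> ball 0 1. Im z < 0}"
    using convex_Int[OF convex_ball convex_halfspace_Im_gt, of 0 1 0]
      convex_Int[OF convex_ball convex_halfspace_Im_lt, of 0 1 0] by (auto simp: Int_def)
  have conn: "connected U" "connected L" unfolding U_def L_def
    by (intro connected_continuous_image continuous_on_subset[OF kcont] convex_connected conv; blast)+
  have UL: "U \<inter> J = {}" "L \<inter> J = {}" using offJ by (auto simp: U_def L_def)
  have meet: "D \<inter> (U \<union> L) \<noteq> {}" if "frontier D = J" "D \<inter> J = {}" for D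
  proof -
    have "p \<in> frontier D" using that(1) fJ by auto
    then have "p \<in> closure D" by (simp add: frontier_def)
    then obtain q where q: "q \<in> D" "q \<in> S"
      using S(1,2) unfolding closure_iff_nhds_not_empty by blast
    then obtain z where z: "z \<in> ball 0 1" "q = k z" using kS by auto
    have "Im z \<noteq> 0" using offJ[OF z(1)] that(2) q z by auto
    then have "q \<in> U \<union> L" using z by (auto simp: U_def L_def neq_iff)
    with q show ?thesis by blast
  qed
  have "A \<inter> (U \<union> L) \<noteq> {}" "B \<inter> (U \<union> L) \<noteq> {}"
    using meet[OF AB(9)] meet[OF AB(10)] AB(8) by blast+
  then have opp: "U \<subseteq> A \<and> L \<subseteq> B \<or> U \<subseteq> B \<and> L \<subseteq> A"
    using side[OF conn(1) UL(1)] side[OF conn(2) UL(2)] AB(7) by blast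
  have pf: "p \<in> f" "p \<noteq> a" "p \<noteq> b"
    using cross f arc_joins_sym[OF f] by (auto simp: properly_cross_at_def arc_interior_def arc_ends_def)
  obtain f1 f2 where f12: "arc_joins f1 a p" "arc_joins f2 p b" "f1 \<union> f2 = f" "f1 \<inter> f2 = {p}"
    using arc_joins_split[OF f pf] by metis
  let ?k = "\<lambda>t::real. k (\<i> * of_real t)"
  obtain s :: real where s: "s = 1 \<or> s = -1"
    and st: "\<And>t. \<lbrakk>0 < t; t < 1\<rbrakk> \<Longrightarrow> ?k (s * t) \<in> f1 - f2 \<and> ?k (- s * t) \<in> f2 - f1"
    using arc_pieces_on_chart_axis[OF hom S(1) k0 _ f12(1,2,4), of \<i>] Sf f12(3)
    unfolding ball_axes by auto
  define z1 z2 where "z1 = ?k (s * (1/2))" and "z2 = ?k (- s * (1/2))"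
  have z: "z1 \<in> f1 - {p}" "z2 \<in> f2 - {p}" using st[of "1/2"] f12(4) by (auto simp: z1_def z2_def)
  have z12: "z1 \<in> U \<and> z2 \<in> L \<or> z1 \<in> L \<and> z2 \<in> U"
    using s by (auto simp: z1_def z2_def U_def L_def norm_mult)
  have "connected ((f1 - {p}) \<union> C \<union> (f2 - {p}))"
    using connected_arc_minus_end[OF f12(1)] connected_arc_minus_end[OF f12(2)]
      C arc_joins_properties[OF f12(1)] arc_joins_properties[OF f12(2)]
    by (intro connected_Un) auto
  moreover have "((f1 - {p}) \<union> C \<union> (f2 - {p})) \<inter> J = {}"
    using C(2) fJ f12(3) by blast
  ultimately have "(f1 - {p}) \<union> C \<union> (f2 - {p}) \<subseteq> A \<or> (f1 - {p}) \<union> C \<union> (f2 - {p}) \<subseteq> B"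
    by (rule side)
  then show False using opp z z12 AB(7) by blast
qed

text \<open>
  If \<open>J\<close> turns at the crossing point, that is, it runs along one piece of \<open>f\<close> and one piece of \<open>g\<close>,
  then the two remaining pieces bound a common quadrant of the chart which \<open>J\<close> avoids.
\<close>

lemma corner_same_side:
  assumes cross: "properly_cross_at f g q"
    and f1: "arc_joins f1 x q" and f2: "arc_joins f2 q x'" and f12: "f1 \<union> f2 = f" "f1 \<inter> f2 = {q}"
    and g1: "arc_joins g1 y q" and g2: "arc_joins g2 q y'" and g12: "g1 \<union> g2 = g" "g1 \<inter> g2 = {q}"
    and W: "open W" "q \<in> W" "W \<inter> J \<subseteq> f1 \<union> g1"
    and J: "f2 \<inter> J = {q}" "g2 \<inter> J = {q}"
  shows "connected_component (- J) x' y'"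
proof -
  obtain S k h where S: "open S" "q \<in> S" "S \<subseteq> W" and hom: "homeomorphism (ball 0 1) S k h"
    and k0: "k 0 = q" and Sf: "S \<inter> f = k ` {z \<in> ball 0 1. Im z = 0}"
    and Sg: "S \<inter> g = k ` {z \<in> ball 0 1. Re z = 0}"
    using properly_cross_at_chart[OF cross W(1,2)] .
  have kS: "k ` ball 0 1 = S" and kcont: "continuous_on (ball 0 1) k" and hk: "\<And>z. z \<in> ball 0 1 \<Longrightarrow> h (k z) = z"
    using hom by (auto simp: homeomorphism_def)
  obtain s :: real where s: "s = 1 \<or> s = -1" and sk: "\<And>t. 0 < t \<Longrightarrow> t < 1 \<Longrightarrow>
      k (1 * of_real (s * t)) \<in> f1 - f2 \<and> k (1 * of_real (- s * t)) \<in> f2 - f1"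
    using arc_pieces_on_chart_axis[OF hom S(1) k0 _ f1 f2 f12(2), of 1] Sf f12(1)
    unfolding ball_axes by auto
  obtain r :: real where r: "r = 1 \<or> r = -1" and rk: "\<And>t. 0 < t \<Longrightarrow> t < 1 \<Longrightarrow>
      k (\<i> * of_real (r * t)) \<in> g1 - g2 \<and> k (\<i> * of_real (- r * t)) \<in> g2 - g1"
    using arc_pieces_on_chart_axis[OF hom S(1) k0 _ g1 g2 g12(2), of \<i>] Sg g12(1)
    unfolding ball_axes by auto
  \<comment> \<open>The closed quadrant between the half axes of \<open>f2\<close> and \<open>g2\<close>, without its corner. The last
      condition removes the origin and keeps the set convex.\<close>
  define Q where "Q = {z \<in> ball 0 1. s * Re z \<le> 0 \<and> r * Im z \<le> 0 \<and> s * Re z + r * Im z < 0}"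
  have "convex Q"
  proof -
    have "Q = ball 0 1 \<inter> {z. inner (Complex s 0) z \<le> 0} \<inter> {z. inner (Complex 0 r) z \<le> 0}
        \<inter> {z. inner (Complex s r) z < 0}"
      by (auto simp: Q_def inner_complex_def)
    then show ?thesis
      by (simp only:) (intro convex_Int convex_ball convex_halfspace_le convex_halfspace_lt)
  qed
  have "connected (k ` Q)"
    by (intro connected_continuous_image continuous_on_subset[OF kcont] convex_connected \<open>convex Q\<close>)
      (auto simp: Q_def)
  have kQ: "k ` Q \<inter> J = {}"
  proof (rule ccontr)
    assume "k ` Q \<inter> J \<noteq> {}"
    then obtain z where z: "z \<in> Q" "k z \<in> J" by auto
    have zb: "z \<in> ball 0 1" using z(1) by (simp add: Q_def)
    have zne: "z \<noteq> 0" using z(1) by (auto simp: Q_def)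
    have "k z \<in> S" using kS zb by blast
    then consider "k z \<in> f1" | "k z \<in> g1" using z(2) W(3) S(3) by blast
    then show False
    proof cases
      case 1
      then have "k z \<in> S \<inter> f" using \<open>k z \<in> S\<close> f12(1) by blast
      then obtain w where "w \<in> ball 0 1" "Im w = 0" "k z = k w" using Sf by auto
      then have "Im z = 0" using hk zb by metis
      moreover from this z(1) have "s * Re z < 0" by (auto simp: Q_def)
      ultimately have "z = 1 * of_real (- s * \<bar>Re z\<bar>)" "\<bar>Re z\<bar> < 1" "\<bar>Re z\<bar> > 0"
        using s zb by (auto simp: complex_eq_iff cmod_eq_Re)
      then have "k z \<in> f2 - f1" using sk[of "\<bar>Re z\<bar>"] by metis
      then show False using 1 by blast
    next
      case 2
      then have "k z \<in> S \<inter> g" using \<open>k z \<in> S\<close> g12(1) by blast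
      then obtain w where "w \<in> ball 0 1" "Re w = 0" "k z = k w" using Sg by auto
      then have "Re z = 0" using hk zb by metis
      moreover from this z(1) have "r * Im z < 0" by (auto simp: Q_def)
      ultimately have "z = \<i> * of_real (- r * \<bar>Im z\<bar>)" "\<bar>Im z\<bar> < 1" "\<bar>Im z\<bar> > 0"
        using r zb by (auto simp: complex_eq_iff cmod_eq_Im)
      then have "k z \<in> g2 - g1" using rk[of "\<bar>Im z\<bar>"] by metis
      then show False using 2 by blast
    qed
  qed
  define z1 z2 where "z1 = k (1 * of_real (- s * (1/2)))" and "z2 = k (\<i> * of_real (- r * (1/2)))"
  have z: "z1 \<in> f2 - {q}" "z2 \<in> g2 - {q}"
    using sk[of "1/2"] rk[of "1/2"] f12(2) g12(2) by (auto simp: z1_def z2_def)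
  have zQ: "z1 \<in> k ` Q" "z2 \<in> k ` Q"
    unfolding z1_def z2_def using s r by (auto intro!: imageI simp: Q_def norm_mult)
  have "connected ((f2 - {q}) \<union> k ` Q \<union> (g2 - {q}))"
    using connected_arc_minus_end(1)[OF f2] connected_arc_minus_end(1)[OF g2] \<open>connected (k ` Q)\<close> z zQ
    by (intro connected_Un) auto
  moreover have "(f2 - {q}) \<union> k ` Q \<union> (g2 - {q}) \<subseteq> - J"
    using kQ J by blast
  moreover have "x' \<in> f2 - {q}" "y' \<in> g2 - {q}"
    using arc_joins_properties[OF f2] arc_joins_properties[OF g2] by auto
  ultimately show ?thesis unfolding connected_component_def by blast
qed

section \<open>Triangles and theta curves\<close>

text \<open>
  The arcs \<open>e\<close>, \<open>f\<close>, \<open>g\<close> contain a Jordan curve with corners \<open>x\<close>, \<open>y\<close>, \<open>q\<close>. The curve turns at \<open>q\<close>, so \<open>x'\<close>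
  and \<open>y'\<close> lie on the same side of it. The arc \<open>h\<close> crosses it exactly once, so \<open>x'\<close> and \<open>b\<close> lie on
  different sides, although \<open>B\<close> connects \<open>b\<close> to \<open>y'\<close> without meeting the curve. The freedom in
  \<open>B\<close> is what makes the lemma applicable to two configurations: a 4-cycle, with \<open>B\<close> a single
  vertex, and three cyclically crossing pairs of edges.
\<close>

lemma triangle_parity:
  assumes e: "arc_joins e x y" and f: "arc_joins f x x'" and g: "arc_joins g y y'"
    and ef: "e \<inter> f = {x}" and eg: "e \<inter> g = {y}" and fg: "f \<inter> g = {q}" "properly_cross_at f g q"
    and h: "arc_joins h x' b" and eh: "e \<inter> h = {p}" "properly_cross_at e h p"
    and hf: "h \<inter> f \<subseteq> {x'}" and hg: "h \<inter> g \<subseteq> {y'}"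
    and B: "connected B" "b \<in> B" "y' \<in> B" "B \<inter> (e \<union> f \<union> g) \<subseteq> {y'}"
  shows False
proof -
  have q: "q \<in> f" "q \<noteq> x" "q \<noteq> x'" "q \<in> g" "q \<noteq> y" "q \<noteq> y'"
    using fg f g arc_joins_sym[OF f] arc_joins_sym[OF g]
    by (auto simp: properly_cross_at_def arc_interior_def arc_ends_def)
  have p: "p \<noteq> x" "p \<noteq> y"
    using eh e arc_joins_sym[OF e] by (auto simp: properly_cross_at_def arc_interior_def arc_ends_def)
  obtain f1 f2 where f12: "arc_joins f1 x q" "arc_joins f2 q x'" "f1 \<union> f2 = f" "f1 \<inter> f2 = {q}"
    and x'f1: "x' \<notin> f1" and xf2: "x \<notin> f2"
    using arc_joins_split[OF f q(1-3)] .
  obtain g1 g2 where g12: "arc_joins g1 y q" "arc_joins g2 q y'" "g1 \<union> g2 = g" "g1 \<inter> g2 = {q}"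
    and y'g1: "y' \<notin> g1" and yg2: "y \<notin> g2"
    using arc_joins_split[OF g q(4-6)] .
  have ends: "x \<in> f1" "y \<in> g1" "q \<in> f1" "q \<in> g1" "q \<in> f2" "q \<in> g2" "y' \<in> g"
    using arc_joins_properties(1,2)[OF f12(1)] arc_joins_properties(1,2)[OF g12(1)]
      f12(4) g12(4) arc_joins_properties(2)[OF g] by auto
  have f1g1: "f1 \<inter> g1 = {q}" using fg(1) f12 g12 by blast
  define d where "d = f1 \<union> g1"
  have d: "arc_joins d x y"
    unfolding d_def by (rule arc_joins_Un[OF f12(1) arc_joins_sym[OF g12(1)] f1g1])
  have ed: "e \<inter> d = {x, y}"
    unfolding d_def using ef eg f12(3) g12(3) ends(1,2) by blast
  define J where "J = e \<union> d"
  have J: "jordan_curve J"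
    unfolding J_def by (rule jordan_curve_two_arcs[OF e arc_joins_sym[OF d] ed])
  have "\<not> connected_component (- J) x' b"
  proof (rule crossing_separates[OF J eh(2)])
    show "open (- d)" using arc_joins_properties[OF d] by (simp add: open_Compl)
    show "p \<in> - d" using ed eh(1) p by blast
    show "- d \<inter> J = - d \<inter> e" by (auto simp: J_def)
    show "arc_joins h x' b" by (rule h)
    show "h \<inter> J = {p}"
      using eh(1) hf hg x'f1 y'g1 f12(3) g12(3) unfolding J_def d_def by blast
  qed
  moreover have "connected_component (- J) x' y'"
  proof (rule corner_same_side[OF fg(2) f12 g12])
    show "open (- e)" using arc_joins_properties(5)[OF e] by (simp add: open_Compl)
    show "q \<in> - e" using ef q by blast
    show "- e \<inter> J \<subseteq> f1 \<union> g1" by (auto simp: J_def d_def)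
    show "f2 \<inter> J = {q}" "g2 \<inter> J = {q}"
      unfolding J_def d_def
      using ef eg fg(1) f12(3,4) g12(3,4) xf2 yg2 ends(3-6) by blast+
  qed
  moreover have "connected_component (- J) b y'"
    unfolding connected_component_def
  proof (intro exI[of _ B] conjI B(1-3))
    have "y' \<noteq> y" using arc_joins_properties(3)[OF g] by simp
    then have "y' \<notin> e" using eg ends(7) by auto
    moreover have "y' \<notin> f" using fg(1) q(6) ends(7) by auto
    ultimately have "y' \<notin> J" using y'g1 f12(3) by (auto simp: J_def d_def)
    then show "B \<subseteq> - J" using B(4) f12(3) g12(3) unfolding J_def d_def by blast
  qed
  ultimately show False
    by (meson connected_component_sym connected_component_trans)
qed

text \<open>
  A point \<open>y\<close> on the side of \<open>c1 \<union> c2\<close> opposite to \<open>z\<close> can be joined to \<open>z\<close> while meeting only \<open>c1\<close>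
  and also while meeting only \<open>c2\<close> among the three arcs. The sets \<open>c1 \<union> d\<close> and \<open>c2 \<union> d\<close> have
  the connected intersection \<open>d\<close>, so by Janiszewski's theorem \<open>y\<close> and \<open>z\<close> are joined within the complement
  of \<open>c1 \<union> c2\<close>, a contradiction. For a theta curve that is a drawing of \<open>K\<^sub>2\<^sub>,\<^sub>3\<close>, with \<open>z\<close> as a sixth
  vertex, this is the nonplanarity of \<open>K\<^sub>3\<^sub>,\<^sub>3\<close>.
\<close>

lemma theta_no_point_reaches_all_arcs:
  assumes c1: "arc_joins c1 a b" and c2: "arc_joins c2 a b" and d: "arc_joins d a b"
    and meets: "c1 \<inter> c2 = {a, b}" "c1 \<inter> d = {a, b}" "c2 \<inter> d = {a, b}"
    and conn: "connected T1" "connected T2" "connected T3"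
    and z: "z \<in> T1" "z \<in> T2" "z \<in> T3"
    and T1: "T1 \<inter> c1 \<noteq> {}" "T1 \<inter> (c2 \<union> d) = {}"
    and T2: "T2 \<inter> c2 \<noteq> {}" "T2 \<inter> (c1 \<union> d) = {}"
    and T3: "T3 \<inter> d \<noteq> {}" "T3 \<inter> (c1 \<union> c2) = {}"
  shows False
proof -
  define J where "J = c1 \<union> c2"
  have J: "jordan_curve J"
    unfolding J_def using c1 arc_joins_sym[OF c2] meets(1) by (rule jordan_curve_two_arcs)
  obtain A B where AB: "A \<noteq> {}" "B \<noteq> {}" "open A" "open B" "connected A" "connected B" "A \<inter> B = {}"
    "A \<union> B = - J" "frontier A = J" "frontier B = J"
    using jordan_curve_sides[OF J] .
  have zJ: "z \<notin> J" using z(3) T3(2) by (auto simp: J_def)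
  have "False" if P: "open P" "open Q" "connected Q" "P \<inter> Q = {}" "P \<union> Q = - J"
    "frontier Q = J" "z \<in> P" "Q \<noteq> {}" for P Q
  proof -
    have side: "C \<subseteq> P \<or> C \<subseteq> Q" if "connected C" "C \<inter> J = {}" for C
      using connected_subset_side[OF P(1,2,4) that(1)] P(5) that(2) by auto
    have dJ: "d \<inter> J = {a, b}" using meets(2,3) by (auto simp: J_def)
    have T3J: "T3 \<inter> J = {}" using T3(2) by (simp add: J_def)
    \<comment> \<open>The arc \<open>d\<close> runs on the side of \<open>z\<close>, because \<open>T3\<close> links them.\<close>
    have "T3 \<union> (d - {a, b}) \<subseteq> P \<or> T3 \<union> (d - {a, b}) \<subseteq> Q"
    proof (rule side)
      show "connected (T3 \<union> (d - {a, b}))"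
        using conn(3) connected_arc_minus_ends[OF d] T3(1) T3J dJ by (intro connected_Un) auto
      show "(T3 \<union> (d - {a, b})) \<inter> J = {}" using T3J dJ by auto
    qed
    then have "d - {a, b} \<subseteq> P" using P(4,7) z(3) by auto
    moreover have "Q \<inter> J = {}" using P(5) by auto
    ultimately have dQ: "Q \<inter> d = {}" using dJ P(4) by auto
    obtain y where y: "y \<in> Q" using P(8) by auto
    \<comment> \<open>The set \<open>Q\<close> is extended through a point of \<open>T\<close> on its frontier \<open>J\<close>.\<close>
    have reach: "connected_component (- (c \<union> d)) y z"
      if T: "connected T" "z \<in> T" "T \<inter> J \<noteq> {}" "T \<inter> (c \<union> d) = {}" and c: "c \<subseteq> J" for T c
    proof -
      obtain u where u: "u \<in> T" "u \<in> J" using T(3) by auto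
      then have "u \<in> closure Q" using P(6) by (auto simp: frontier_def)
      then have "connected (insert u Q)"
        by (intro connected_intermediate_closure[OF P(3)]) (use closure_subset[of Q] in auto)
      then have "connected (insert u Q \<union> T)"
        using T(1) u(1) by (intro connected_Un) auto
      moreover have "insert u Q \<union> T \<subseteq> - (c \<union> d)"
        using T(4) u(1) dQ \<open>Q \<inter> J = {}\<close> c by auto
      ultimately show ?thesis
        unfolding connected_component_def using y T(2) by blast
    qed
    have "connected_component (- ((c1 \<union> d) \<union> (c2 \<union> d))) y z"
    proof (rule Janiszewski_weak)
      show "compact (c1 \<union> d)" "compact (c2 \<union> d)"
        using arc_joins_properties(4) c1 c2 d by blast+
      have "(c1 \<union> d) \<inter> (c2 \<union> d) = d"
        using meets by auto
      then show "connected ((c1 \<union> d) \<inter> (c2 \<union> d))" using arc_joins_properties(6)[OF d] by simp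
      show "connected_component (- (c1 \<union> d)) y z"
        using conn(2) z(2) T2 by (intro reach[of T2]) (auto simp: J_def)
      show "connected_component (- (c2 \<union> d)) y z"
        using conn(1) z(1) T1 by (intro reach[of T1]) (auto simp: J_def)
    qed
    then obtain C where C: "connected C" "C \<subseteq> - ((c1 \<union> d) \<union> (c2 \<union> d))" "y \<in> C" "z \<in> C"
      unfolding connected_component_def by blast
    then have "C \<subseteq> P \<or> C \<subseteq> Q" by (intro side) (auto simp: J_def)
    then show False using C(3,4) y P(4,7) by auto
  qed
  from this[of A B] this[of B A] show False using AB zJ by blast
qed

section \<open>Crossings in drawings of complete bipartite graphs\<close>

text \<open>
  Indexing the arcs by pairs of vertices makes the combinatorics of crossings expressible without
  recovering the ends of an edge from its point set.
\<close>

locale bipartite_drawing =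
  fixes U V :: "complex set" and E :: "complex \<Rightarrow> complex \<Rightarrow> complex set"
  assumes disjoint: "U \<inter> V = {}"
    and joins: "\<lbrakk>u \<in> U; v \<in> V\<rbrakk> \<Longrightarrow> arc_joins (E u v) u v"
    and vertices_on_edge: "\<lbrakk>u \<in> U; v \<in> V\<rbrakk> \<Longrightarrow> E u v \<inter> (U \<union> V) = {u, v}"
    and at_most_one: "\<lbrakk>u \<in> U; v \<in> V; u' \<in> U; v' \<in> V; (u, v) \<noteq> (u', v')\<rbrakk> \<Longrightarrow>
      \<exists>p. E u v \<inter> E u' v' \<subseteq> {p}"
    and proper: "\<lbrakk>u \<in> U; v \<in> V; u' \<in> U; v' \<in> V; u \<noteq> u'; v \<noteq> v'; p \<in> E u v \<inter> E u' v'\<rbrakk> \<Longrightarrow>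
      properly_cross_at (E u v) (E u' v') p"
begin

lemma joins': "\<lbrakk>u \<in> U; v \<in> V\<rbrakk> \<Longrightarrow> arc_joins (E u v) v u"
  using joins arc_joins_sym by blast

lemma ends_on_edge: "\<lbrakk>u \<in> U; v \<in> V\<rbrakk> \<Longrightarrow> u \<in> E u v \<and> v \<in> E u v"
  using vertices_on_edge by blast

lemma adjacent_at_U: "\<lbrakk>u \<in> U; v \<in> V; v' \<in> V; v \<noteq> v'\<rbrakk> \<Longrightarrow> E u v \<inter> E u v' = {u}"
  using at_most_one[of u v u v'] ends_on_edge[of u v] ends_on_edge[of u v'] by blast

lemma adjacent_at_V: "\<lbrakk>u \<in> U; u' \<in> U; v \<in> V; u \<noteq> u'\<rbrakk> \<Longrightarrow> E u v \<inter> E u' v = {v}"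
  using at_most_one[of u v u' v] ends_on_edge[of u v] ends_on_edge[of u' v] by blast

lemma crossing_point:
  assumes "u \<in> U" "v \<in> V" "u' \<in> U" "v' \<in> V" "u \<noteq> u'" "v \<noteq> v'" "E u v \<inter> E u' v' \<noteq> {}"
  obtains p where "E u v \<inter> E u' v' = {p}" "properly_cross_at (E u v) (E u' v') p"
    "p \<notin> U" "p \<notin> V"
proof -
  obtain p where p: "E u v \<inter> E u' v' = {p}"
    using assms at_most_one[of u v u' v'] by auto
  moreover have "p \<notin> U \<union> V"
  proof
    assume "p \<in> U \<union> V"
    then have "p \<in> {u, v} \<inter> {u', v'}"
      using vertices_on_edge[of u v] vertices_on_edge[of u' v'] p assms(1-4) by auto
    then show False using assms(1-6) disjoint by auto
  qed
  moreover have "properly_cross_at (E u v) (E u' v') p"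
    using proper[OF assms(1-6)] p by auto
  ultimately show thesis using that by auto
qed

text \<open>
  If both pairs of opposite edges of a 4-cycle crossed, then three of its edges would bound a triangle
  with a crossing as one corner, and the fourth edge would join the two free ends of that corner while
  crossing the triangle exactly once.
\<close>

lemma four_cycle_one_crossing:
  assumes uv: "u \<in> U" "u' \<in> U" "v \<in> V" "v' \<in> V" "u \<noteq> u'" "v \<noteq> v'"
    and X: "E u v \<inter> E u' v' \<noteq> {}"
  shows "E u v' \<inter> E u' v = {}"
proof (rule ccontr)
  assume X': "E u v' \<inter> E u' v \<noteq> {}"
  obtain p where p: "E u v \<inter> E u' v' = {p}" "properly_cross_at (E u v) (E u' v') p"
    using crossing_point[OF uv(1,3,2,4,5,6) X] .
  obtain q where q: "E u v' \<inter> E u' v = {q}" "properly_cross_at (E u v') (E u' v) q"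
    using crossing_point[OF uv(1,4,2,3,5) uv(6)[symmetric] X'] .
  show False
  proof (rule triangle_parity[where B = "{u'}"])
    show "arc_joins (E u v) u v" "arc_joins (E u v') u v'" "arc_joins (E u' v) v u'"
      "arc_joins (E u' v') v' u'"
      using joins joins' uv by auto
    show "E u v \<inter> E u v' = {u}" "E u v \<inter> E u' v = {v}"
      using adjacent_at_U adjacent_at_V uv by auto
    show "E u' v' \<inter> E u v' \<subseteq> {v'}" "E u' v' \<inter> E u' v \<subseteq> {u'}"
      using adjacent_at_U[of u' v' v] adjacent_at_V[of u' u v'] uv by auto
    show "{u'} \<inter> (E u v \<union> E u v' \<union> E u' v) \<subseteq> {u'}" by auto
  qed (use p q in simp_all)
qed

text \<open>
  Write \<open>u \<rightarrow> w\<close> if the edge \<open>uv\<close> crosses the edge \<open>wv'\<close>. A 3-cycle \<open>u \<rightarrow> w \<rightarrow> x \<rightarrow> u\<close> is excluded by the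
  triangle formed by \<open>uv\<close> and the crossing edges \<open>uv'\<close>, \<open>xv\<close>. The edge \<open>wv'\<close> crosses it once, and its
  end \<open>w\<close> is linked to \<open>x\<close> along \<open>wv\<close> up to the crossing of \<open>wv\<close> and \<open>xv'\<close>, and from there along \<open>xv'\<close>.
  These two pieces meet the edges \<open>uv\<close>, \<open>uv'\<close>, \<open>xv\<close> only at \<open>x\<close>, since each further crossing
  would be the second one in some 4-cycle.
\<close>

lemma no_cyclic_crossings:
  assumes U: "u \<in> U" "w \<in> U" "x \<in> U" "u \<noteq> w" "w \<noteq> x" "u \<noteq> x"
    and V: "v \<in> V" "v' \<in> V" "v \<noteq> v'"
    and uw: "E u v \<inter> E w v' \<noteq> {}" and wx: "E w v \<inter> E x v' \<noteq> {}"
  shows "E x v \<inter> E u v' = {}"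
proof (rule ccontr)
  assume xu: "E x v \<inter> E u v' \<noteq> {}"
  obtain p where p: "E u v \<inter> E w v' = {p}" "properly_cross_at (E u v) (E w v') p"
    using crossing_point[OF U(1) V(1) U(2) V(2) U(4) V(3) uw] .
  obtain r where r: "E w v \<inter> E x v' = {r}" "properly_cross_at (E w v) (E x v') r" "r \<notin> U" "r \<notin> V"
    using crossing_point[OF U(2) V(1) U(3) V(2) U(5) V(3) wx] .
  obtain q where q: "E u v' \<inter> E x v = {q}" "properly_cross_at (E u v') (E x v) q"
    using crossing_point[OF U(1) V(2) U(3) V(1) U(6) V(3)[symmetric]] xu by (auto simp: Int_commute)
  have none: "E u v' \<inter> E w v = {}" "E w v' \<inter> E x v = {}" "E x v' \<inter> E u v = {}"
    using four_cycle_one_crossing[of u w v v'] four_cycle_one_crossing[of w x v v']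
      four_cycle_one_crossing[of x u v v'] U V uw wx xu by auto
  obtain a a' where a: "arc_joins a w r" "arc_joins a' r v" "a \<union> a' = E w v" "a \<inter> a' = {r}"
    and va: "v \<notin> a"
    using arc_joins_split[OF joins[of w v], of r] U V r by (metis IntD1 insertI1)
  obtain c c' where c: "arc_joins c x r" "arc_joins c' r v'" "c \<union> c' = E x v'" "c \<inter> c' = {r}"
    and vc: "v' \<notin> c"
    using arc_joins_split[OF joins[of x v'], of r] U V r by (metis IntD2 insertI1)
  note props = arc_joins_properties[OF a(1)] arc_joins_properties[OF c(1)]
  show False
  proof (rule triangle_parity[where B = "a \<union> c"])
    show "arc_joins (E u v) u v" "arc_joins (E u v') u v'" "arc_joins (E x v) v x"
      "arc_joins (E w v') v' w"
      using joins joins' U V by auto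
    show "E u v \<inter> E u v' = {u}" "E u v \<inter> E x v = {v}"
      using adjacent_at_U adjacent_at_V U V by auto
    show "E w v' \<inter> E u v' \<subseteq> {v'}" "E w v' \<inter> E x v \<subseteq> {x}"
      using adjacent_at_V[of w u v'] none U V by auto
    show "connected (a \<union> c)" using props by (intro connected_Un) auto
    show "w \<in> a \<union> c" "x \<in> a \<union> c" using props by auto
    have wv: "E w v \<inter> E u v = {v}" "E w v \<inter> E x v = {v}"
      using adjacent_at_V[of w u v] adjacent_at_V[of w x v] U V by auto
    have xv': "E x v' \<inter> E u v' = {v'}" "E x v' \<inter> E x v = {x}"
      using adjacent_at_V[of x u v'] adjacent_at_U[of x v' v] U V by auto
    have "a \<inter> (E u v \<union> E u v' \<union> E x v) \<subseteq> {v} - {v}"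
    proof -
      have "a \<inter> (E u v \<union> E u v' \<union> E x v) \<subseteq> E w v \<inter> (E u v \<union> E u v' \<union> E x v)" using a(3) by auto
      also have "\<dots> \<subseteq> {v}" using wv none(1) by (simp add: Int_Un_distrib Int_commute)
      finally show ?thesis using va by auto
    qed
    moreover have "c \<inter> (E u v \<union> E u v' \<union> E x v) \<subseteq> {x, v'} - {v'}"
    proof -
      have "c \<inter> (E u v \<union> E u v' \<union> E x v) \<subseteq> E x v' \<inter> (E u v \<union> E u v' \<union> E x v)" using c(3) by auto
      also have "\<dots> \<subseteq> {x, v'}" using xv' none(3) by (simp add: Int_Un_distrib Int_commute)
      finally show ?thesis using vc by auto
    qed
    ultimately show "(a \<union> c) \<inter> (E u v \<union> E u v' \<union> E x v) \<subseteq> {x}" by blast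
  qed (use p q in simp_all)
qed

text \<open>
  Without a crossing, the paths through \<open>u1\<close>, \<open>u2\<close>, \<open>u3\<close> from \<open>v1\<close> to \<open>v2\<close> form a theta curve and \<open>v3\<close> has
  access to all three of them.
\<close>

lemma K33_has_crossing:
  assumes U: "u1 \<in> U" "u2 \<in> U" "u3 \<in> U" "u1 \<noteq> u2" "u1 \<noteq> u3" "u2 \<noteq> u3"
    and V: "v1 \<in> V" "v2 \<in> V" "v3 \<in> V" "v1 \<noteq> v2" "v1 \<noteq> v3" "v2 \<noteq> v3"
  shows "\<exists>u\<in>{u1,u2,u3}. \<exists>u'\<in>{u1,u2,u3}. \<exists>v\<in>{v1,v2,v3}. \<exists>v'\<in>{v1,v2,v3}.
    u \<noteq> u' \<and> v \<noteq> v' \<and> E u v \<inter> E u' v' \<noteq> {}"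
proof (rule ccontr)
  assume "\<not> ?thesis"
  then have none: "E u v \<inter> E u' v' = {}" if "u \<in> {u1,u2,u3}" "u' \<in> {u1,u2,u3}" "v \<in> {v1,v2,v3}"
    "v' \<in> {v1,v2,v3}" "u \<noteq> u'" "v \<noteq> v'" for u u' v v'
    using that by blast
  have UV: "u \<in> U" if "u \<in> {u1,u2,u3}" for u using that U by auto
  have VV: "v \<in> V" if "v \<in> {v1,v2,v3}" for v using that V by auto
  have arcs: "arc_joins (E u v) u v" "arc_joins (E u v) v u" "compact (E u v)" "connected (E u v)"
    "u \<in> E u v" "v \<in> E u v" if "u \<in> {u1,u2,u3}" "v \<in> {v1,v2,v3}" for u v
    using joins[OF UV[OF that(1)] VV[OF that(2)]] joins'[OF UV[OF that(1)] VV[OF that(2)]]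
      arc_joins_properties[OF joins[OF UV[OF that(1)] VV[OF that(2)]]] by auto
  have adjU: "E u v \<inter> E u v' = {u}" if "u \<in> {u1,u2,u3}" "v \<in> {v1,v2,v3}" "v' \<in> {v1,v2,v3}" "v \<noteq> v'" for u v v'
    using adjacent_at_U UV VV that by blast
  have adjV: "E u v \<inter> E u' v = {v}" if "u \<in> {u1,u2,u3}" "u' \<in> {u1,u2,u3}" "v \<in> {v1,v2,v3}" "u \<noteq> u'" for u u' v
    using adjacent_at_V UV VV that by blast
  have theta: "arc_joins (E u v1 \<union> E u v2) v1 v2" "connected (E u v3)" "v3 \<in> E u v3"
    "E u v3 \<inter> (E u v1 \<union> E u v2) \<noteq> {}" if "u \<in> {u1,u2,u3}" for u
  proof -
    have "u \<in> E u v3 \<inter> (E u v1 \<union> E u v2)" using arcs(5)[OF that] by auto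
    then show "E u v3 \<inter> (E u v1 \<union> E u v2) \<noteq> {}" by blast
  qed (use arc_joins_Un[OF arcs(2)[OF that] arcs(1)[OF that] adjU[OF that]] V arcs[OF that] in auto)
  have meet: "(E u v1 \<union> E u v2) \<inter> (E u' v1 \<union> E u' v2) = {v1, v2}"
    and reach: "E u v3 \<inter> (E u' v1 \<union> E u' v2) = {}"
    if "u \<in> {u1,u2,u3}" "u' \<in> {u1,u2,u3}" "u \<noteq> u'" for u u'
  proof -
    have *: "E u v1 \<inter> E u' v1 = {v1}" "E u v2 \<inter> E u' v2 = {v2}" "E u v1 \<inter> E u' v2 = {}"
      "E u v2 \<inter> E u' v1 = {}" "E u v3 \<inter> E u' v1 = {}" "E u v3 \<inter> E u' v2 = {}"
      using adjV[OF that(1,2) _ that(3)] none[OF that(1,2) _ _ that(3)] V by auto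
    show "(E u v1 \<union> E u v2) \<inter> (E u' v1 \<union> E u' v2) = {v1, v2}" using *(1-4) by blast
    show "E u v3 \<inter> (E u' v1 \<union> E u' v2) = {}" using *(5,6) by blast
  qed
  have U': "u1 \<noteq> u2" "u1 \<noteq> u3" "u2 \<noteq> u3" "u2 \<noteq> u1" "u3 \<noteq> u1" "u3 \<noteq> u2" using U by auto
  have reach': "E u v3 \<inter> ((E u' v1 \<union> E u' v2) \<union> (E u'' v1 \<union> E u'' v2)) = {}"
    if "u \<in> {u1,u2,u3}" "u' \<in> {u1,u2,u3}" "u \<noteq> u'" "u'' \<in> {u1,u2,u3}" "u \<noteq> u''" for u u' u''
    using reach[OF that(1,2,3)] reach[OF that(1,4,5)] by blast
  have mem: "u1 \<in> {u1,u2,u3}" "u2 \<in> {u1,u2,u3}" "u3 \<in> {u1,u2,u3}" by auto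
  show False
    by (rule theta_no_point_reaches_all_arcs[OF mem[THEN theta(1)]
          meet[OF mem(1,2) U'(1)] meet[OF mem(1,3) U'(2)] meet[OF mem(2,3) U'(3)]
          mem[THEN theta(2)] mem[THEN theta(3)]
          theta(4)[OF mem(1)] reach'[OF mem(1,2) U'(1) mem(3) U'(2)]
          theta(4)[OF mem(2)] reach'[OF mem(2,1) U'(4) mem(3) U'(3)]
          theta(4)[OF mem(3)] reach'[OF mem(3,1) U'(5) mem(2) U'(6)]])
qed

lemma arc_ends_edge: "\<lbrakk>u \<in> U; v \<in> V\<rbrakk> \<Longrightarrow> arc_ends (E u v) = {u, v}"
  by (rule arc_ends_eq[OF joins])

lemma crosses_edge_iff:
  assumes "u \<in> U" "v \<in> V" "u' \<in> U" "v' \<in> V"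
  shows "crosses (E u v) (E u' v') \<longleftrightarrow> u \<noteq> u' \<and> v \<noteq> v' \<and> E u v \<inter> E u' v' \<noteq> {}"
proof
  assume "crosses (E u v) (E u' v')"
  then obtain p where p: "properly_cross_at (E u v) (E u' v') p" by (auto simp: crosses_def)
  then have pi: "p \<in> E u v \<inter> E u' v'" "p \<notin> {u, v}"
    using assms by (auto simp: properly_cross_at_def arc_interior_def arc_ends_edge)
  have "u \<noteq> u'"
  proof
    assume "u = u'"
    moreover have "v \<noteq> v'" using p not_properly_cross_self \<open>u = u'\<close> by blast
    ultimately show False using adjacent_at_U[of u v v'] assms pi by auto
  qed
  moreover have "v \<noteq> v'"
    using adjacent_at_V[of u u' v] assms pi \<open>u \<noteq> u'\<close> by auto
  ultimately show "u \<noteq> u' \<and> v \<noteq> v' \<and> E u v \<inter> E u' v' \<noteq> {}" using pi by auto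
next
  assume "u \<noteq> u' \<and> v \<noteq> v' \<and> E u v \<inter> E u' v' \<noteq> {}"
  then show "crosses (E u v) (E u' v')"
    using proper[of u v u' v'] assms by (auto simp: crosses_def)
qed

lemma topological_graph_of_vertex_subsets:
  assumes "finite A" "finite B" "A \<subseteq> U" "B \<subseteq> V"
  shows "topological_graph \<lparr>verts = A \<union> B, edges = {E u v | u v. u \<in> A \<and> v \<in> B}\<rparr>"
  unfolding topological_graph_def tgraph.simps
proof (intro conjI ballI impI)
  have "{E u v | u v. u \<in> A \<and> v \<in> B} = (\<lambda>(u, v). E u v) ` (A \<times> B)" by auto
  then show "finite {E u v | u v. u \<in> A \<and> v \<in> B}" using assms(1,2) by simp
  show "finite (A \<union> B)" using assms(1,2) by simp
next
  fix e assume "e \<in> {E u v | u v. u \<in> A \<and> v \<in> B}"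
  then obtain u v where uv: "e = E u v" "u \<in> A" "v \<in> B" by auto
  then have "e \<inter> (A \<union> B) = {u, v}"
    using vertices_on_edge[of u v] ends_on_edge[of u v] assms(3,4) by auto
  then show "\<exists>x\<in>A \<union> B. \<exists>y\<in>A \<union> B. arc_joins e x y \<and> e \<inter> (A \<union> B) = {x, y}"
    using joins[of u v] uv assms(3,4) by (intro bexI[of _ u] bexI[of _ v]) auto
next
  fix e f p assume e: "e \<in> {E u v | u v. u \<in> A \<and> v \<in> B}" and f: "f \<in> {E u v | u v. u \<in> A \<and> v \<in> B}"
    and ef: "e \<noteq> f" and p: "p \<in> arc_interior e \<inter> arc_interior f"
  obtain u v where "e = E u v" "u \<in> U" "v \<in> V" using e assms(3,4) by auto
  moreover obtain u' v' where "f = E u' v'" "u' \<in> U" "v' \<in> V" using f assms(3,4) by auto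
  ultimately have uv: "e = E u v" "f = E u' v'" "u \<in> U" "v \<in> V" "u' \<in> U" "v' \<in> V" by auto
  have pn: "p \<in> E u v \<inter> E u' v'" "p \<noteq> u" "p \<noteq> v"
    using p uv by (auto simp: arc_interior_def arc_ends_edge)
  have "u \<noteq> u'"
  proof
    assume "u = u'"
    moreover from this have "v \<noteq> v'" using ef uv by auto
    ultimately show False using adjacent_at_U[of u v v'] pn uv by auto
  qed
  moreover have "v \<noteq> v'" using adjacent_at_V[of u u' v] pn uv \<open>u \<noteq> u'\<close> by auto
  ultimately show "properly_cross_at e f p" using proper[of u v u' v' p] uv pn(1) by auto
qed

end

lemma complete_bipartite_simple_tgraph_drawing:
  assumes "complete_bipartite_simple_tgraph G U V"
  obtains E where "bipartite_drawing U V E" "\<And>u v. \<lbrakk>u \<in> U; v \<in> V\<rbrakk> \<Longrightarrow> E u v \<in> edges G"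
proof -
  have simple: "simple_topological_graph G" and VG: "verts G = U \<union> V" and UV: "U \<inter> V = {}"
    and bij: "bij_betw arc_ends (edges G) {{u, v} | u v. u \<in> U \<and> v \<in> V}"
    using assms by (auto simp: complete_bipartite_simple_tgraph_def)
  define E where "E = (\<lambda>u v. the_inv_into (edges G) arc_ends {u, v})"
  have E: "E u v \<in> edges G" "arc_ends (E u v) = {u, v}" if "u \<in> U" "v \<in> V" for u v
  proof -
    have inj: "inj_on arc_ends (edges G)" and im: "{u, v} \<in> arc_ends ` edges G"
      using bij that unfolding bij_betw_def by auto
    show "E u v \<in> edges G" "arc_ends (E u v) = {u, v}"
      unfolding E_def using the_inv_into_into[OF inj im order.refl] f_the_inv_into_f[OF inj im] by auto
  qed
  have on: "arc_joins (E u v) u v \<and> E u v \<inter> (U \<union> V) = {u, v}" if uv: "u \<in> U" "v \<in> V" for u v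
  proof -
    obtain x y where xy: "arc_joins (E u v) x y" "E u v \<inter> (U \<union> V) = {x, y}"
      using simple E(1)[OF uv] VG unfolding simple_topological_graph_def topological_graph_def by metis
    then have "{x, y} = {u, v}" using arc_ends_eq E(2)[OF uv] by metis
    then show ?thesis using xy arc_joins_sym[OF xy(1)] by (auto simp: doubleton_eq_iff)
  qed
  have ne: "E u v \<noteq> E u' v'" if "u \<in> U" "v \<in> V" "u' \<in> U" "v' \<in> V" "(u, v) \<noteq> (u', v')" for u v u' v'
  proof
    assume "E u v = E u' v'"
    then have "{u, v} = {u', v'}" using E(2) that by metis
    then show False using that UV by (auto simp: doubleton_eq_iff)
  qed
  have "bipartite_drawing U V E"
  proof
    show "U \<inter> V = {}" by (rule UV)
  next
    fix u v assume "u \<in> U" "v \<in> V"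
    then show "arc_joins (E u v) u v" "E u v \<inter> (U \<union> V) = {u, v}" using on by auto
  next
    fix u v u' v' assume *: "u \<in> U" "v \<in> V" "u' \<in> U" "v' \<in> V" "(u, v) \<noteq> (u', v')"
    then show "\<exists>p. E u v \<inter> E u' v' \<subseteq> {p}"
      using simple E(1) ne[OF *] unfolding simple_topological_graph_def by blast
  next
    fix u v u' v' p assume *: "u \<in> U" "v \<in> V" "u' \<in> U" "v' \<in> V" "u \<noteq> u'" "v \<noteq> v'" "p \<in> E u v \<inter> E u' v'"
    have "p \<notin> U \<union> V"
    proof
      assume "p \<in> U \<union> V"
      then have "p \<in> {u, v} \<inter> {u', v'}" using on[OF *(1,2)] on[OF *(3,4)] *(7) by auto
      then show False using * UV by auto
    qed
    then have "p \<in> arc_interior (E u v) \<inter> arc_interior (E u' v')"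
      using *(7) E(2)[OF *(1,2)] E(2)[OF *(3,4)] *(1-4) by (auto simp: arc_interior_def)
    then show "properly_cross_at (E u v) (E u' v') p"
      using simple E(1)[OF *(1,2)] E(1)[OF *(3,4)] ne[OF *(1-4)] *(5)
      unfolding simple_topological_graph_def topological_graph_def by auto
  qed
  then show thesis using that E(1) by blast
qed

section \<open>Ramsey bounds\<close>

text \<open>
  Only triples of distinct elements are required to be transitive, because the relation to which this
  is applied holds between every vertex and itself. A new element is inserted between its
  predecessors and the remaining elements.
\<close>

lemma tournament_sorted_list:
  assumes "finite A"
    and total: "\<And>x y. \<lbrakk>x \<in> A; y \<in> A; x \<noteq> y\<rbrakk> \<Longrightarrow> R x y \<or> R y x"
    and trans: "\<And>x y z. \<lbrakk>x \<in> A; y \<in> A; z \<in> A; x \<noteq> y; y \<noteq> z; x \<noteq> z; R x y; R y z\<rbrakk> \<Longrightarrow> R x z"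
  shows "\<exists>xs. distinct xs \<and> set xs = A \<and> sorted_wrt R xs"
  using assms
proof (induction A rule: finite_induct)
  case empty
  show ?case by simp
next
  case (insert a A)
  have "\<exists>xs. distinct xs \<and> set xs = A \<and> sorted_wrt R xs"
  proof (rule insert.IH)
    show "R x y \<or> R y x" if "x \<in> A" "y \<in> A" "x \<noteq> y" for x y
      using insert.prems(1)[of x y] that by simp
    show "R x z" if "x \<in> A" "y \<in> A" "z \<in> A" "x \<noteq> y" "y \<noteq> z" "x \<noteq> z" "R x y" "R y z" for x y z
      using insert.prems(2)[of x y z] that by simp
  qed
  then obtain xs where xs: "distinct xs" "set xs = A" "sorted_wrt R xs" by blast
  let ?ys = "filter (\<lambda>y. R y a) xs @ a # filter (\<lambda>y. \<not> R y a) xs"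
  have "distinct ?ys" "set ?ys = insert a A"
    using xs insert.hyps by auto
  moreover have "sorted_wrt R ?ys"
  proof -
    have right: "R a z" if "z \<in> A" "\<not> R z a" for z
      using that insert.prems(1)[of z a] insert.hyps by auto
    have "R y z" if "y \<in> A" "R y a" "z \<in> A" "\<not> R z a" for y z
    proof -
      have "y \<noteq> z" using that(2,4) by auto
      moreover have "y \<noteq> a" "a \<noteq> z" using that(1,3) insert.hyps by auto
      ultimately show ?thesis using that right[OF that(3,4)] insert.prems(2)[of y a z] by simp
    qed
    then show ?thesis
      using xs right by (simp add: sorted_wrt_append sorted_wrt_filter)
  qed
  ultimately show ?case by blast
qed

text \<open>
  The bound \<open>k\<^sup>2\<close> on the Ramsey number \<open>R(3,k)\<close>: the non-neighbours of a vertex form a clique, so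
  either there are at least \<open>k\<close> of them, or at most \<open>k\<close> vertices, and so at most
  \<open>k\<^sup>2 - (k - 1)\<^sup>2 = 2k - 1\<close>, are lost on passing to the neighbourhood.
\<close>

lemma clique_without_independent_triple:
  assumes "finite A" "k ^ 2 \<le> card A"
    and sym: "\<And>x y. P x y \<Longrightarrow> P y x"
    and no3: "\<And>x y z. \<lbrakk>x \<in> A; y \<in> A; z \<in> A; x \<noteq> y; x \<noteq> z; y \<noteq> z\<rbrakk> \<Longrightarrow> P x y \<or> P x z \<or> P y z"
  shows "\<exists>K\<subseteq>A. card K = k \<and> (\<forall>x\<in>K. \<forall>y\<in>K. x \<noteq> y \<longrightarrow> P x y)"
  using assms(1,2,4)
proof (induction k arbitrary: A)
  case 0
  then show ?case by (intro exI[of _ "{}"]) auto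
next
  case (Suc k)
  have "A \<noteq> {}" using Suc.prems(2) by auto
  then obtain x where x: "x \<in> A" by blast
  define M where "M = {y \<in> A - {x}. \<not> P x y}"
  define N where "N = {y \<in> A - {x}. P x y}"
  have fin: "finite M" "finite N" using Suc.prems(1) by (auto simp: M_def N_def)
  have card: "card M + card N + 1 = card A"
  proof -
    have "card (M \<union> N) = card M + card N"
      using fin by (intro card_Un_disjoint) (auto simp: M_def N_def)
    moreover have "M \<union> N = A - {x}" by (auto simp: M_def N_def)
    ultimately show ?thesis
      using x Suc.prems(1) card_Suc_Diff1[of A x] by simp
  qed
  show ?case
  proof (cases "Suc k \<le> card M")
    case True
    then obtain K where K: "K \<subseteq> M" "card K = Suc k" by (meson obtain_subset_with_card_n)
    have "P y z" if "y \<in> K" "z \<in> K" "y \<noteq> z" for y z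
      using Suc.prems(3)[of x y z] x that K(1) unfolding M_def by auto
    then show ?thesis using K by (intro exI[of _ K]) (auto simp: M_def)
  next
    case False
    have "k ^ 2 \<le> card N"
      using False card Suc.prems(2) by (simp add: power2_eq_square)
    then obtain K where K: "K \<subseteq> N" "card K = k" "\<forall>y\<in>K. \<forall>z\<in>K. y \<noteq> z \<longrightarrow> P y z"
      using Suc.IH[of N] fin Suc.prems(3) unfolding N_def by blast
    have "x \<notin> K" "finite K" using K(1) fin finite_subset by (auto simp: N_def)
    then have "card (insert x K) = Suc k" using K(2) by simp
    moreover have "insert x K \<subseteq> A" using K(1) x by (auto simp: N_def)
    moreover have "\<forall>y\<in>insert x K. \<forall>z\<in>insert x K. y \<noteq> z \<longrightarrow> P y z"
      using K(1,3) sym by (auto simp: N_def)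
    ultimately show ?thesis by blast
  qed
qed

text \<open>
  The bound is multiplicative in the colours because each step fixes the least element and passes to
  a large colour class among the pairs that contain it, which costs a factor \<open>c\<close> and lowers
  the demand of one colour by one. Different demands for different colours are needed for
  this induction.
\<close>

lemma ramsey_pairs_asymmetric:
  fixes A :: "nat set" and s :: "'c \<Rightarrow> nat"
  assumes C: "finite C" "C \<noteq> {}" "card C \<le> c" "2 \<le> c"
    and "finite A" "c ^ sum s C \<le> card A"
    and "\<And>i j. \<lbrakk>i \<in> A; j \<in> A; i < j\<rbrakk> \<Longrightarrow> col i j \<in> C"
  shows "\<exists>q\<in>C. \<exists>B\<subseteq>A. card B = s q + 1 \<and> (\<forall>i\<in>B. \<forall>j\<in>B. i < j \<longrightarrow> col i j = q)"
  using assms(5-7)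
proof (induction "sum s C" arbitrary: s A)
  case 0
  have "A \<noteq> {}" using 0 by auto
  then obtain a where a: "a \<in> A" by blast
  obtain q where q: "q \<in> C" using C by blast
  have "s q = 0" using 0(1) C(1) q by simp
  then show ?case using a q by (intro bexI[of _ q] exI[of _ "{a}"]) auto
next
  case (Suc n)
  show ?case
  proof (cases "\<exists>q\<in>C. s q = 0")
    case True
    then obtain q where q: "q \<in> C" "s q = 0" by blast
    have "A \<noteq> {}" using Suc.prems(2) C(4) by auto
    then obtain a where "a \<in> A" by blast
    then show ?thesis using q by (intro bexI[of _ q] exI[of _ "{a}"]) auto
  next
    case False
    have "A \<noteq> {}" using Suc.prems(2) C(4) by auto
    define a where "a = Min A"
    have a: "a \<in> A" "\<And>j. j \<in> A \<Longrightarrow> a \<le> j"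
      using Suc.prems(1) \<open>A \<noteq> {}\<close> by (auto simp: a_def)
    define N where "N = (\<lambda>q. {j \<in> A - {a}. col a j = q})"
    have less: "a < j" if "j \<in> A - {a}" for j using a(2)[of j] that by auto
    have "\<exists>q\<in>C. c ^ n \<le> card (N q)"
    proof (rule ccontr)
      assume "\<not> ?thesis"
      then have small: "card (N q) \<le> c ^ n - 1" if "q \<in> C" for q using that by force
      have "A - {a} = (\<Union>q\<in>C. N q)"
        using Suc.prems(3)[OF a(1)] less by (fastforce simp: N_def)
      then have "card (A - {a}) \<le> (\<Sum>q\<in>C. card (N q))"
        using card_UN_le[OF C(1), of N] by simp
      also have "\<dots> \<le> card C * (c ^ n - 1)" using sum_bounded_above[of C "\<lambda>q. card (N q)"] small by simp
      also have "\<dots> \<le> c * (c ^ n - 1)" using C(3) by (rule mult_le_mono1)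
      also have "\<dots> = c ^ Suc n - c" by (simp add: diff_mult_distrib2)
      finally have "card A - 1 \<le> c ^ Suc n - c" using a Suc.prems(1) by simp
      moreover have "c ^ Suc n \<le> card A" using Suc.prems(2) Suc.hyps(2) by simp
      moreover have "c \<le> c ^ Suc n" using C(4) by (intro self_le_power) auto
      \<comment> \<open>The element \<open>a\<close> itself costs one, which is less than the slack \<open>c\<close>.\<close>
      ultimately show False using C(4) by linarith
    qed
    then obtain q where q: "q \<in> C" "c ^ n \<le> card (N q)" by blast
    have sq: "s q > 0" using False q by auto
    define t where "t = s(q := s q - 1)"
    have "sum t C = n"
    proof -
      have "sum s C = s q + sum s (C - {q})" "sum t C = t q + sum t (C - {q})"
        using C(1) q(1) by (auto intro: sum.remove)
      moreover have "sum t (C - {q}) = sum s (C - {q})" by (rule sum.cong) (auto simp: t_def)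
      ultimately show ?thesis using Suc.hyps(2) sq by (simp add: t_def)
    qed
    then have "\<exists>q'\<in>C. \<exists>B\<subseteq>N q. card B = t q' + 1 \<and> (\<forall>i\<in>B. \<forall>j\<in>B. i < j \<longrightarrow> col i j = q')"
      using Suc.hyps(1)[of t "N q"] Suc.prems(1,3) q(2) by (auto simp: N_def)
    then obtain q' B where B: "q' \<in> C" "B \<subseteq> N q" "card B = t q' + 1"
      "\<forall>i\<in>B. \<forall>j\<in>B. i < j \<longrightarrow> col i j = q'" by blast
    have BA: "B \<subseteq> A - {a}" using B(2) by (auto simp: N_def)
    show ?thesis
    proof (cases "q' = q")
      case False
      then show ?thesis using B BA by (intro bexI[of _ q'] exI[of _ B]) (auto simp: t_def)
    next
      case True
      have "finite B" using B(3) card_ge_0_finite[of B] by simp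
      then have "card (insert a B) = s q + 1"
        using BA B(3) sq True by (auto simp: t_def card_insert_if)
      moreover have "\<forall>i\<in>insert a B. \<forall>j\<in>insert a B. i < j \<longrightarrow> col i j = q"
      proof (intro ballI impI)
        fix i j assume ij: "i \<in> insert a B" "j \<in> insert a B" "i < j"
        have "j \<noteq> a" using ij(1,3) less[of i] BA by auto
        then have "j \<in> B" using ij(2) by simp
        then show "col i j = q"
          using ij(1,3) B(2,4) True by (cases "i = a") (auto simp: N_def)
      qed
      ultimately show ?thesis using q(1) BA a(1) by (intro bexI[of _ q] exI[of _ "insert a B"]) auto
    qed
  qed
qed

lemma ramsey_pairs:
  fixes A :: "nat set"
  assumes C: "finite C" "card C \<le> c" "2 \<le> c" and k: "1 \<le> k"
    and A: "finite A" "c ^ (c * (k - 1)) \<le> card A"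
    and col: "\<And>i j. \<lbrakk>i \<in> A; j \<in> A; i < j\<rbrakk> \<Longrightarrow> col i j \<in> C" and ne: "C \<noteq> {}"
  obtains q B where "q \<in> C" "B \<subseteq> A" "card B = k" "\<And>i j. \<lbrakk>i \<in> B; j \<in> B; i < j\<rbrakk> \<Longrightarrow> col i j = q"
proof -
  have "c ^ sum (\<lambda>_. k - 1) C \<le> c ^ (c * (k - 1))"
    using C by (intro power_increasing) auto
  then have "\<exists>q\<in>C. \<exists>B\<subseteq>A. card B = (k - 1) + 1 \<and> (\<forall>i\<in>B. \<forall>j\<in>B. i < j \<longrightarrow> col i j = q)"
    using A col by (intro ramsey_pairs_asymmetric[OF C(1) ne C(2,3)]) auto
  then show thesis using that k by auto
qed

text \<open>
  The estimate is crude: \<open>c \<le> 2 ^ c\<close> turns the claim into \<open>c\<^sup>2 (k - 1) \<le> k ^ (5k)\<close>, and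
  \<open>c\<^sup>2 = 4 k ^ (4k)\<close> leaves a factor \<open>k ^ k\<close> for \<open>4 (k - 1)\<close>.
\<close>

lemma colour_count_bound:
  fixes k :: nat
  assumes "3 \<le> k"
  defines "c \<equiv> 2 * (k\<^sup>2) ^ k"
  shows "c ^ (c * (k - 1)) \<le> 2 ^ (k ^ (5 * k))"
proof -
  have "c ^ (c * (k - 1)) \<le> (2 ^ c) ^ (c * (k - 1))"
    by (intro power_mono) (auto intro: less_imp_le less_exp)
  also have "\<dots> = 2 ^ (c * (c * (k - 1)))" by (simp add: power_mult)
  also have "\<dots> \<le> 2 ^ (k ^ (5 * k))"
  proof (rule power_increasing)
    have "c * (c * (k - 1)) \<le> 4 * k * k ^ (4 * k)"
    proof -
      have "c * c = 4 * k ^ (4 * k)"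
        by (simp add: c_def power_mult[symmetric] power_add[symmetric])
      then have "c * (c * (k - 1)) = (k - 1) * (4 * k ^ (4 * k))" by (metis mult.assoc mult.commute)
      also have "\<dots> \<le> k * (4 * k ^ (4 * k))" by (rule mult_le_mono1) simp
      finally show ?thesis by (simp add: mult_ac)
    qed
    also have "4 * k \<le> k ^ k"
    proof -
      have "4 * k \<le> k * k * k" using assms(1) mult_le_mono[OF assms(1) assms(1)] by simp
      also have "\<dots> = k ^ 3" by (simp add: power3_eq_cube)
      also have "\<dots> \<le> k ^ k" using assms(1) by (intro power_increasing) auto
      finally show ?thesis .
    qed
    then have "4 * k * k ^ (4 * k) \<le> k ^ k * k ^ (4 * k)" by simp
    also have "\<dots> = k ^ (5 * k)" by (simp add: power_add[symmetric])
    finally show "c * (c * (k - 1)) \<le> k ^ (5 * k)" .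
  qed simp
  finally show ?thesis .
qed

section \<open>Ordered crossing patterns\<close>

context bipartite_drawing
begin

text \<open>
  For vertices \<open>v\<close>, \<open>v'\<close> of \<open>V\<close>, let \<open>x\<close> and \<open>y\<close> in \<open>U\<close> be adjacent if one of the two pairs of opposite edges of
  their 4-cycle crosses. On a clique the orientation by the crossing pair is a transitive
  tournament, so the clique can be listed in order. Each pair of vertices in \<open>V\<close> is
  coloured by such an ordered \<open>k\<close>-clique or by an independent triple, one of which exists. A
  set of \<open>k\<close> vertices with only one colour cannot have a triple as its colour, since
  this would be a drawing of \<open>K\<^sub>3\<^sub>,\<^sub>3\<close> without crossings. For \<open>k = 2\<close> a single crossing of
  \<open>K\<^sub>3\<^sub>,\<^sub>3\<close> is what is asked for; the colouring is used for \<open>k \<ge> 3\<close>, where a monochromatic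
  set has at least three elements.
\<close>

lemma ordered_crossing_lists:
  assumes k: "1 \<le> k" and U: "card U > 2 * (k - 1) ^ 4" and V: "card V \<ge> 2 ^ (k ^ (5 * k))"
  obtains us vs where "length us = k" "length vs = k" "distinct us" "distinct vs" "set us \<subseteq> U" "set vs \<subseteq> V"
    "\<And>i i' j j'. \<lbrakk>i < i'; i' < k; j < j'; j' < k\<rbrakk> \<Longrightarrow> E (us ! i) (vs ! j') \<inter> E (us ! i') (vs ! j) \<noteq> {}"
proof -
  consider "k = 1" | "k = 2" | "3 \<le> k" using k by linarith
  then show thesis
  proof cases
    case 1
    have "U \<noteq> {}" "V \<noteq> {}" using U V by force+
    then obtain u v where "u \<in> U" "v \<in> V" by blast
    then show thesis using that[of "[u]" "[v]"] 1 by simp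
  next
    case 2
    have "3 \<le> card U" using U 2 by simp
    moreover have "(2::nat) ^ 2 \<le> 2 ^ (2 ^ (5 * 2))" by (rule power_increasing) auto
    then have "3 \<le> card V" using V 2 by simp
    ultimately obtain U3 V3 where "U3 \<subseteq> U" "card U3 = 3" "V3 \<subseteq> V" "card V3 = 3"
      by (metis obtain_subset_with_card_n)
    then obtain u1 u2 u3 v1 v2 v3 where *: "u1 \<in> U" "u2 \<in> U" "u3 \<in> U" "u1 \<noteq> u2" "u1 \<noteq> u3" "u2 \<noteq> u3"
      "v1 \<in> V" "v2 \<in> V" "v3 \<in> V" "v1 \<noteq> v2" "v1 \<noteq> v3" "v2 \<noteq> v3"
      by (auto simp: card_3_iff)
    obtain u u' v v' where c: "u \<in> {u1,u2,u3}" "u' \<in> {u1,u2,u3}" "v \<in> {v1,v2,v3}" "v' \<in> {v1,v2,v3}"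
      "u \<noteq> u'" "v \<noteq> v'" "E u v \<inter> E u' v' \<noteq> {}"
      using K33_has_crossing[OF *] by blast
    show thesis
    proof (rule that[of "[u, u']" "[v', v]"])
      show "E ([u, u'] ! i) ([v', v] ! j') \<inter> E ([u, u'] ! i') ([v', v] ! j) \<noteq> {}"
        if "i < i'" "i' < k" "j < j'" "j' < k" for i i' j j'
      proof -
        have "i = 0" "i' = 1" "j = 0" "j' = 1" using that 2 by auto
        then show ?thesis using c(7) by simp
      qed
    qed (use c * 2 in auto)
  next
    case 3
    \<comment> \<open>The clique lemma asks for \<open>k\<^sup>2\<close> vertices; exactly as many are kept, to bound the number
        of colours in terms of \<open>k\<close>.\<close>
    have "k ^ 2 \<le> card U"
    proof -
      have "k \<le> 2 * (k - 1)" using 3 by simp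
      also have "\<dots> \<le> (k - 1) * (k - 1)" using 3 by (intro mult_le_mono1) simp
      finally have "k ^ 2 \<le> ((k - 1) ^ 2) ^ 2" by (intro power_mono) (auto simp: power2_eq_square)
      also have "\<dots> = (k - 1) ^ 4" by (simp add: power_mult[symmetric])
      finally show ?thesis using U by simp
    qed
    then obtain U0 where U0: "U0 \<subseteq> U" "card U0 = k ^ 2" "finite U0"
      by (metis obtain_subset_with_card_n)
    have finV: "finite V" using V by (intro card_ge_0_finite) (meson zero_less_numeral zero_less_power less_le_trans)
    obtain g where g: "bij_betw g {0..<card V} V" using ex_bij_betw_nat_finite[OF finV] by blast
    have gV: "g i \<in> V" if "i < card V" for i using g that by (auto simp: bij_betw_def)
    have ginj: "g i \<noteq> g j" if "i < card V" "j < card V" "i \<noteq> j" for i j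
      using g that by (auto simp: bij_betw_def inj_on_def)
    \<comment> \<open>The roles of \<open>g i\<close> and \<open>g j\<close> are chosen so that a sorted list of \<open>U\<close> and an increasing
        list of \<open>V\<close> cross in the way in which segments between two vertical lines do.\<close>
    define R where "R = (\<lambda>i j x y. E x (g j) \<inter> E y (g i) \<noteq> {})"
    define C where "C = Inl ` {us. set us \<subseteq> U0 \<and> length us = k} \<union> Inr ` {us. set us \<subseteq> U0 \<and> length us = 3}"
    define good where "good = (\<lambda>i j q. case q of
        Inl us \<Rightarrow> distinct us \<and> sorted_wrt (R i j) us
      | Inr us \<Rightarrow> distinct us \<and> (\<forall>x\<in>set us. \<forall>y\<in>set us. x \<noteq> y \<longrightarrow> \<not> R i j x y))"
    have ex: "\<exists>q\<in>C. good i j q" if ij: "i < j" "j < card V" for i j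
    proof -
      let ?P = "\<lambda>x y. R i j x y \<or> R i j y x"
      have gij: "g i \<in> V" "g j \<in> V" "g i \<noteq> g j" using gV[of i] gV[of j] ginj[of i j] ij by auto
      show ?thesis
      proof (cases "\<forall>x\<in>U0. \<forall>y\<in>U0. \<forall>z\<in>U0. x \<noteq> y \<longrightarrow> x \<noteq> z \<longrightarrow> y \<noteq> z \<longrightarrow> ?P x y \<or> ?P x z \<or> ?P y z")
        case True
        then obtain K where K: "K \<subseteq> U0" "card K = k" "\<forall>x\<in>K. \<forall>y\<in>K. x \<noteq> y \<longrightarrow> ?P x y"
          using clique_without_independent_triple[of U0 k ?P] U0 by auto
        have KU: "x \<in> U" if "x \<in> K" for x using that K U0 by auto
        have "\<exists>xs. distinct xs \<and> set xs = K \<and> sorted_wrt (R i j) xs"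
        proof (rule tournament_sorted_list)
          show "finite K" using K(1) U0(3) finite_subset by blast
          show "R i j x y \<or> R i j y x" if "x \<in> K" "y \<in> K" "x \<noteq> y" for x y
            using K(3) that by auto
          fix x y z assume xyz: "x \<in> K" "y \<in> K" "z \<in> K" "x \<noteq> y" "y \<noteq> z" "x \<noteq> z" "R i j x y" "R i j y z"
          have "\<not> R i j z x"
            using no_cyclic_crossings[OF KU[OF xyz(1)] KU[OF xyz(2)] KU[OF xyz(3)] xyz(4-6)
                gij(2,1) gij(3)[symmetric]] xyz(7,8) by (auto simp: R_def)
          then show "R i j x z" using K(3) xyz by auto
        qed
        then obtain xs where xs: "distinct xs" "set xs = K" "sorted_wrt (R i j) xs" by blast
        then have "length xs = k" using distinct_card K(2) by metis
        then show ?thesis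
          using xs K(1) by (intro bexI[of _ "Inl xs"]) (auto simp: good_def C_def)
      next
        case False
        then obtain x y z where "x \<in> U0" "y \<in> U0" "z \<in> U0" "x \<noteq> y" "x \<noteq> z" "y \<noteq> z"
          "\<not> (?P x y \<or> ?P x z \<or> ?P y z)" by blast
        then show ?thesis by (intro bexI[of _ "Inr [x, y, z]"]) (auto simp: good_def C_def)
      qed
    qed
    define col where "col = (\<lambda>i j. SOME q. q \<in> C \<and> good i j q)"
    have col: "col i j \<in> C" "good i j (col i j)" if "i < j" "j < card V" for i j
      using someI_ex[of "\<lambda>q. q \<in> C \<and> good i j q"] ex[OF that] by (auto simp: col_def)
    have finC: "finite C"
      unfolding C_def using finite_lists_length_eq[OF U0(3)] by auto
    have cardC: "card C \<le> 2 * (k\<^sup>2) ^ k"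
    proof -
      have "card C \<le> card {us. set us \<subseteq> U0 \<and> length us = k} + card {us. set us \<subseteq> U0 \<and> length us = 3}"
        unfolding C_def using finite_lists_length_eq[OF U0(3)]
        by (intro order.trans[OF card_Un_le] add_mono card_image_le) auto
      also have "\<dots> = (k\<^sup>2) ^ k + (k\<^sup>2) ^ 3" using card_lists_length_eq[OF U0(3)] U0(2) by simp
      also have "(k\<^sup>2) ^ 3 \<le> (k\<^sup>2) ^ k" using 3 by (intro power_increasing) auto
      finally show ?thesis by simp
    qed
    have "1 \<le> (k\<^sup>2) ^ k" using 3 by simp
    then have c2: "2 \<le> 2 * (k\<^sup>2) ^ k" by linarith
    have big: "(2 * (k\<^sup>2) ^ k) ^ (2 * (k\<^sup>2) ^ k * (k - 1)) \<le> card {0..<card V}"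
      using order.trans[OF colour_count_bound[OF 3] V] by simp
    have "k < 2 ^ (k ^ (5 * k))"
    proof -
      have "k \<le> k ^ (5 * k)" using 3 by (intro self_le_power) auto
      then show ?thesis using less_exp[of "k ^ (5 * k)"] by linarith
    qed
    then have "C \<noteq> {}" using ex[of 0 1] V 3 by auto
    obtain q B where q: "q \<in> C" and B: "B \<subseteq> {0..<card V}" "card B = k"
      and mono: "\<And>i j. \<lbrakk>i \<in> B; j \<in> B; i < j\<rbrakk> \<Longrightarrow> col i j = q"
      using ramsey_pairs[OF finC cardC c2 k _ big _ \<open>C \<noteq> {}\<close>, of col] col(1) by auto
    have goodB: "good i j q" if "i \<in> B" "j \<in> B" "i < j" for i j
      using col(2)[of i j] mono[OF that] subsetD[OF B(1) that(2)] that by auto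
    have BV: "g i \<in> V" if "i \<in> B" for i using gV B(1) that by auto
    have Binj: "g i \<noteq> g j" if "i \<in> B" "j \<in> B" "i \<noteq> j" for i j
      using ginj[of i j] subsetD[OF B(1) that(1)] subsetD[OF B(1) that(2)] that by auto
    show thesis
    proof (cases q)
      case (Inl us)
      have finB: "finite B" using B(1) finite_subset by blast
      define bs where "bs = sorted_list_of_set B"
      have bs: "length bs = k" "set bs = B" "distinct bs" "sorted_wrt (<) bs"
        using finB B(2) by (auto simp: bs_def)
      have us: "set us \<subseteq> U0" "length us = k" using q Inl by (auto simp: C_def)
      have lt: "bs ! j < bs ! j'" "bs ! j \<in> B" "bs ! j' \<in> B" if "j < j'" "j' < k" for j j'
        using bs that sorted_wrt_nth_less[OF bs(4), of j j'] by auto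
      have goodu: "distinct us" "sorted_wrt (R (bs ! 0) (bs ! 1)) us"
        using goodB[OF lt(2,3,1)[of 0 1]] 3 Inl by (auto simp: good_def)
      show thesis
      proof (rule that[of us "map g bs"])
        show "distinct (map g bs)"
          using bs Binj by (auto simp: distinct_map inj_on_def)
        show "E (us ! i) (map g bs ! j') \<inter> E (us ! i') (map g bs ! j) \<noteq> {}"
          if "i < i'" "i' < k" "j < j'" "j' < k" for i i' j j'
        proof -
          have "sorted_wrt (R (bs ! j) (bs ! j')) us"
            using goodB[OF lt(2,3,1)[OF that(3,4)]] Inl by (simp add: good_def)
          then have "R (bs ! j) (bs ! j') (us ! i) (us ! i')"
            using sorted_wrt_nth_less that us by metis
          then show ?thesis using that bs(1) by (simp add: R_def)
        qed
      qed (use bs us U0 goodu BV in auto)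
    next
      case (Inr us)
      have us: "set us \<subseteq> U0" "length us = 3" using q Inr by (auto simp: C_def)
      obtain B3 where "B3 \<subseteq> B" "card B3 = 3" using 3 B(2) by (metis obtain_subset_with_card_n)
      then obtain b1 b2 b3 where b: "b1 \<in> B" "b2 \<in> B" "b3 \<in> B" "b1 \<noteq> b2" "b1 \<noteq> b3" "b2 \<noteq> b3"
        by (auto simp: card_3_iff)
      have none: "E x (g i) \<inter> E y (g j) = {}"
        if "x \<in> set us" "y \<in> set us" "x \<noteq> y" "i \<in> B" "j \<in> B" "i \<noteq> j" for x y i j
      proof (cases "i < j")
        case True
        then have "\<not> R i j y x" using goodB[of i j] that Inr by (auto simp: good_def)
        then show ?thesis by (auto simp: R_def)
      next
        case False
        then have "\<not> R j i x y" using goodB[of j i] that Inr by (auto simp: good_def)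
        then show ?thesis by (auto simp: R_def)
      qed
      have "distinct us" 
        using goodB[of b1 b2] goodB[of b2 b1] b Inr by (cases "b1 < b2") (auto simp: good_def)
      obtain x y z where xyz: "us = [x, y, z]"
        using us(2) by (metis (no_types) length_0_conv length_Suc_conv numeral_3_eq_3)
      have "x \<in> U" "y \<in> U" "z \<in> U" "x \<noteq> y" "x \<noteq> z" "y \<noteq> z"
        using \<open>distinct us\<close> us(1) U0(1) xyz by auto
      from K33_has_crossing[OF this BV[OF b(1)] BV[OF b(2)] BV[OF b(3)]
          Binj[OF b(1,2,4)] Binj[OF b(1,3,5)] Binj[OF b(2,3,6)]]
      have "\<exists>u\<in>set us. \<exists>u'\<in>set us. \<exists>w\<in>{g b1, g b2, g b3}. \<exists>w'\<in>{g b1, g b2, g b3}.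
          u \<noteq> u' \<and> w \<noteq> w' \<and> E u w \<inter> E u' w' \<noteq> {}"
        by (simp only: xyz list.set)
      then obtain u u' w w' where c: "u \<in> set us" "u' \<in> set us" "w \<in> {g b1, g b2, g b3}"
        "w' \<in> {g b1, g b2, g b3}" "u \<noteq> u'" "w \<noteq> w'" "E u w \<inter> E u' w' \<noteq> {}"
        by blast
      then obtain i j where "i \<in> B" "j \<in> B" "w = g i" "w' = g j" "i \<noteq> j" using b by auto
      then show thesis using none[of u u' i j] c by auto
    qed
  qed
qed

end

section \<open>Segments between two vertical lines\<close>

abbreviation strip_segment :: "real \<Rightarrow> real \<Rightarrow> complex set" where
  "strip_segment y y' \<equiv> closed_segment (Complex 0 y) (Complex 1 y')"

lemma strip_segment_iff:
  "z \<in> strip_segment y y' \<longleftrightarrow> 0 \<le> Re z \<and> Re z \<le> 1 \<and> Im z = (1 - Re z) * y + Re z * y'"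
proof
  assume "z \<in> strip_segment y y'"
  then obtain u where "0 \<le> u" "u \<le> 1" "z = (1 - u) *\<^sub>R Complex 0 y + u *\<^sub>R Complex 1 y'"
    by (auto simp: in_segment)
  then show "0 \<le> Re z \<and> Re z \<le> 1 \<and> Im z = (1 - Re z) * y + Re z * y'" by auto
next
  assume "0 \<le> Re z \<and> Re z \<le> 1 \<and> Im z = (1 - Re z) * y + Re z * y'"
  then show "z \<in> strip_segment y y'"
    unfolding in_segment by (intro exI[of _ "Re z"]) (auto simp: complex_eq_iff)
qed

lemma arc_ends_strip_segment: "arc_ends (strip_segment y y') = {Complex 0 y, Complex 1 y'}"
proof (rule arc_ends_eq)
  show "arc_joins (strip_segment y y') (Complex 0 y) (Complex 1 y')"
    unfolding arc_joins_def
    by (intro exI[of _ "linepath (Complex 0 y) (Complex 1 y')"]) auto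
qed

text \<open>
  In the coordinates along the directions of the two segments, scaled by \<open>K\<close>, the crossing point \<open>p\<close> is
  the origin and the segments lie on the axes. The factor \<open>K\<close> is so large that the unit ball in these
  coordinates does not reach the ends of the segments.
\<close>

lemma strip_segments_cross:
  assumes opp: "(a - a') * (b - b') < 0"
  shows "crosses (strip_segment a b) (strip_segment a' b')"
proof -
  define D where "D = (a - a') - (b - b')"
  define t where "t = (a - a') / D"
  have D: "D \<noteq> 0" and t: "0 < t" "t < 1"
    using opp by (auto simp: D_def t_def mult_less_0_iff divide_simps)
  have tD: "t * D = a - a'" using D by (simp add: t_def)
  define p where "p = Complex t ((1 - t) * a + t * b)"
  have p': "Im p = (1 - t) * a' + t * b'"
    using tD by (simp add: p_def D_def algebra_simps)
  define K where "K = 1 / min t (1 - t)"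
  have K: "K > 0" using t by (simp add: K_def)
  have Kt: "0 \<le> t + r / K" "t + r / K \<le> 1" if "\<bar>r\<bar> < 1" for r
  proof -
    have "\<bar>r / K\<bar> = \<bar>r\<bar> * min t (1 - t)" using t by (simp add: K_def abs_mult)
    also have "\<dots> \<le> 1 * min t (1 - t)" using that t by (intro mult_right_mono) auto
    finally have "\<bar>r / K\<bar> \<le> t" "\<bar>r / K\<bar> \<le> 1 - t" by (simp_all only: mult_1 min.bounded_iff)
    then show "0 \<le> t + r / K" "t + r / K \<le> 1" by linarith+
  qed
  define m where "m = b - a"
  define m' where "m' = b' - a'"
  have mm: "m' - m = D" by (simp add: m_def m'_def D_def)
  define h where "h = (\<lambda>z. of_real (K / D) * Complex (m' * Re (z - p) - Im (z - p)) (Im (z - p) - m * Re (z - p)))"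
  define h' where "h' = (\<lambda>w. p + of_real (1 / K) * Complex (Re w + Im w) (m * Re w + m' * Im w))"
  have hh': "h (h' w) = w" for w
  proof -
    let ?x = "Re w + Im w" and ?y = "m * Re w + m' * Im w"
    have "m' * (?x / K) - ?y / K = D * Re w / K"
      by (simp add: mm[symmetric] diff_divide_distrib[symmetric] algebra_simps)
    moreover have "?y / K - m * (?x / K) = D * Im w / K"
      by (simp add: mm[symmetric] diff_divide_distrib[symmetric] algebra_simps)
    moreover have "Re (h' w - p) = ?x / K" "Im (h' w - p) = ?y / K"
      by (simp_all add: h'_def)
    ultimately show ?thesis
      unfolding h_def using K D by (simp add: complex_eq_iff)
  qed
  have h'h: "h' (h z) = z" for z
  proof -
    let ?x = "Re (z - p)" and ?y = "Im (z - p)"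
    have h: "Re (h z) = K / D * (m' * ?x - ?y)" "Im (h z) = K / D * (?y - m * ?x)"
      by (simp_all add: h_def)
    have "Re (h z) + Im (h z) = K / D * (D * ?x)"
      unfolding h by (simp add: mm[symmetric] algebra_simps)
    moreover have "m * Re (h z) + m' * Im (h z) = K / D * (D * ?y)"
      unfolding h by (simp add: mm[symmetric] algebra_simps)
    ultimately show ?thesis
      unfolding h'_def using K D by (simp add: complex_eq_iff)
  qed
  have conth: "continuous_on A h" for A
    unfolding h_def Complex_eq by (intro continuous_intros)
  have conth': "continuous_on A h'" for A
    unfolding h'_def Complex_eq by (intro continuous_intros)
  define S where "S = h -` ball 0 1"
  have "open S" unfolding S_def using conth[of UNIV] by (simp add: continuous_on_open_vimage)
  moreover have hp: "h p = 0" by (simp add: h_def complex_eq_iff)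
  then have "p \<in> S" by (simp add: S_def)
  moreover have "homeomorphism S (ball 0 1) h h'"
    by (rule homeomorphismI) (auto simp: hh' h'h S_def conth conth')
  moreover have "h ` (S \<inter> strip_segment a b) = {z \<in> ball 0 1. Im z = 0}"
  proof (intro subset_antisym subsetI)
    fix w assume "w \<in> h ` (S \<inter> strip_segment a b)"
    then obtain z where z: "z \<in> S" "z \<in> strip_segment a b" "w = h z" by auto
    then have "Im (z - p) = m * Re (z - p)"
      by (simp add: strip_segment_iff p_def m_def algebra_simps)
    then show "w \<in> {z \<in> ball 0 1. Im z = 0}" using z by (simp add: S_def h_def)
  next
    fix w assume w: "w \<in> {z \<in> ball (0::complex) 1. Im z = 0}"
    have "\<bar>Re w\<bar> < 1" using w abs_Re_le_cmod[of w] by simp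
    then have "h' w \<in> strip_segment a b"
    proof -
      define r where "r = Re w / K"
      have "Re (h' w) = t + r" "Im (h' w) = (1 - t) * a + t * b + m * r"
        using w by (simp_all add: h'_def p_def r_def)
      then show ?thesis
        using Kt[of "Re w", folded r_def] \<open>\<bar>Re w\<bar> < 1\<close> unfolding strip_segment_iff
        by (simp add: m_def algebra_simps)
    qed
    moreover have "h' w \<in> S" using w by (simp add: S_def hh')
    ultimately show "w \<in> h ` (S \<inter> strip_segment a b)" using hh'[of w] by (metis IntI imageI)
  qed
  moreover have "h ` (S \<inter> strip_segment a' b') = {z \<in> ball 0 1. Re z = 0}"
  proof (intro subset_antisym subsetI)
    fix w assume "w \<in> h ` (S \<inter> strip_segment a' b')"
    then obtain z where z: "z \<in> S" "z \<in> strip_segment a' b'" "w = h z" by auto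
    then have "Im (z - p) = m' * Re (z - p)"
      using p' by (simp add: strip_segment_iff m'_def p_def algebra_simps)
    then show "w \<in> {z \<in> ball 0 1. Re z = 0}" using z by (simp add: S_def h_def)
  next
    fix w assume w: "w \<in> {z \<in> ball (0::complex) 1. Re z = 0}"
    have "\<bar>Im w\<bar> < 1" using w abs_Im_le_cmod[of w] by simp
    then have "h' w \<in> strip_segment a' b'"
    proof -
      define r where "r = Im w / K"
      have "Re (h' w) = t + r" "Im (h' w) = Im p + m' * r"
        using w by (simp_all add: h'_def p_def r_def)
      then show ?thesis
        using Kt[of "Im w", folded r_def] \<open>\<bar>Im w\<bar> < 1\<close> unfolding strip_segment_iff
        by (simp add: p' m'_def algebra_simps)
    qed
    moreover have "h' w \<in> S" using w by (simp add: S_def hh')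
    ultimately show "w \<in> h ` (S \<inter> strip_segment a' b')" using hh'[of w] by (metis IntI imageI)
  qed
  moreover have "p \<in> arc_interior (strip_segment a b)" "p \<in> arc_interior (strip_segment a' b')"
    using t p' by (auto simp: arc_interior_def arc_ends_strip_segment strip_segment_iff p_def)
  ultimately show ?thesis
    unfolding crosses_def properly_cross_at_def using hp by blast
qed

text \<open>
  At a common point with abscissa \<open>t\<close>, the differences of the heights at both lines satisfy
  \<open>(1 - t) (a - a') + t (b - b') = 0\<close>, so they have opposite signs unless both vanish and the
  segments coincide.
\<close>

lemma crosses_strip_segments_iff:
  "crosses (strip_segment a b) (strip_segment a' b') \<longleftrightarrow> (a - a') * (b - b') < 0"
proof
  assume "crosses (strip_segment a b) (strip_segment a' b')"
  then obtain p where p: "properly_cross_at (strip_segment a b) (strip_segment a' b') p"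
    by (auto simp: crosses_def)
  then have pp: "p \<in> strip_segment a b" "p \<in> strip_segment a' b'" "p \<noteq> Complex 0 a" "p \<noteq> Complex 1 b"
    by (auto simp: properly_cross_at_def arc_interior_def arc_ends_strip_segment)
  define t where "t = Re p"
  have im: "0 \<le> t" "t \<le> 1" "Im p = (1 - t) * a + t * b" "Im p = (1 - t) * a' + t * b'"
    using pp by (auto simp: strip_segment_iff t_def)
  have t: "0 < t" "t < 1"
    using im pp(3,4) by (auto simp: less_le t_def complex_eq_iff)
  have eq: "(1 - t) * (a - a') = - t * (b - b')" using im(3,4) by (simp add: algebra_simps)
  have "b \<noteq> b'"
  proof
    assume "b = b'"
    moreover from this have "a = a'" using eq t by simp
    ultimately show False using p not_properly_cross_self by blast
  qed
  have "(1 - t) * ((a - a') * (b - b')) = - t * (b - b') ^ 2"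
    using eq by (simp add: power2_eq_square mult.assoc[symmetric])
  also have "\<dots> < 0" using t \<open>b \<noteq> b'\<close> by simp
  finally show "(a - a') * (b - b') < 0" using t by (simp add: mult_less_0_iff)
qed (rule strip_segments_cross)

section \<open>Copies of \<open>C\<^sub>k\<^sub>,\<^sub>k\<close>\<close>

lemma bij_betw_match_parametrizations:
  assumes "inj_on a I" "inj_on b I"
  obtains \<phi> where "bij_betw \<phi> (a ` I) (b ` I)" "\<And>i. i \<in> I \<Longrightarrow> \<phi> (a i) = b i"
proof
  show "bij_betw (b \<circ> the_inv_into I a) (a ` I) (b ` I)"
    using assms by (intro bij_betw_trans[OF bij_betw_the_inv_into]) (auto simp: bij_betw_def)
  show "(b \<circ> the_inv_into I a) (a i) = b i" if "i \<in> I" for i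
    using assms(1) that by (simp add: the_inv_into_f_f)
qed

context bipartite_drawing
begin

text \<open>
  The required crossings determine all others: two disjoint edges whose ends are in the same order
  are opposite edges of a 4-cycle whose other opposite edges cross.
\<close>

lemma ordered_crossings_weakly_isomorphic:
  assumes len: "length us = s" "length vs = t" and dist: "distinct us" "distinct vs"
    and sub: "set us \<subseteq> U" "set vs \<subseteq> V"
    and X: "\<And>i i' j j'. \<lbrakk>i < i'; i' < s; j < j'; j' < t\<rbrakk> \<Longrightarrow> E (us ! i) (vs ! j') \<inter> E (us ! i') (vs ! j) \<noteq> {}"
  shows "weakly_isomorphic \<lparr>verts = set us \<union> set vs, edges = {E u v | u v. u \<in> set us \<and> v \<in> set vs}\<rparr>
    (C_graph s t)"
proof -
  have uU: "us ! i \<in> U" if "i < s" for i using that len(1) sub(1) nth_mem by blast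
  have vV: "vs ! j \<in> V" if "j < t" for j using that len(2) sub(2) nth_mem by blast
  have ueq: "us ! i = us ! i' \<longleftrightarrow> i = i'" if "i < s" "i' < s" for i i'
    using that len(1) dist(1) by (simp add: nth_eq_iff_index_eq)
  have veq: "vs ! j = vs ! j' \<longleftrightarrow> j = j'" if "j < t" "j' < t" for j j'
    using that len(2) dist(2) by (simp add: nth_eq_iff_index_eq)
  have uv: "us ! i \<noteq> vs ! j" if "i < s" "j < t" for i j
    using uU[OF that(1)] vV[OF that(2)] disjoint by auto
  \<comment> \<open>Both graphs are parametrized by positions in the two lists, and the isomorphism matches
      equal positions.\<close>
  define IV :: "(nat + nat) set" where "IV = Inl ` {..<s} \<union> Inr ` {..<t}"
  define IE :: "(nat \<times> nat) set" where "IE = {..<s} \<times> {..<t}"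
  define av where "av = case_sum (\<lambda>i. us ! i) (\<lambda>j. vs ! j)"
  define bv where "bv = case_sum (\<lambda>i. Complex 0 (real i)) (\<lambda>j. Complex 1 (real j))"
  define ae where "ae = (\<lambda>(i, j). E (us ! i) (vs ! j))"
  define be where "be = (\<lambda>(i, j). strip_segment (real i) (real j))"
  have ends_a: "arc_ends (ae (i, j)) = {us ! i, vs ! j}" if "i < s" "j < t" for i j
    using that by (simp add: ae_def arc_ends_edge uU vV)
  have ends_b: "arc_ends (be (i, j)) = {Complex 0 (real i), Complex 1 (real j)}" for i j
    by (simp add: be_def arc_ends_strip_segment)
  have inj_av: "inj_on av IV"
    by (auto simp: inj_on_def IV_def av_def ueq veq uv uv[symmetric])
  have inj_bv: "inj_on bv IV"
    by (auto simp: inj_on_def IV_def bv_def)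
  have inj_ae: "inj_on ae IE"
  proof (rule inj_onI, clarify)
    fix i j i' j' assume *: "(i, j) \<in> IE" "(i', j') \<in> IE" "ae (i, j) = ae (i', j')"
    then have "{us ! i, vs ! j} = {us ! i', vs ! j'}"
      using ends_a[of i j] ends_a[of i' j'] by (auto simp: IE_def)
    then show "i = i' \<and> j = j'"
      using * ueq[of i i'] veq[of j j'] uv[of i j'] uv[of i' j] by (auto simp: IE_def doubleton_eq_iff)
  qed
  have inj_be: "inj_on be IE"
  proof (rule inj_onI, clarify)
    fix i j i' j' assume "be (i, j) = be (i', j')"
    then have "{Complex 0 (real i), Complex 1 (real j)} = {Complex 0 (real i'), Complex 1 (real j')}"
      using ends_b by metis
    then show "i = i' \<and> j = j'" by (auto simp: doubleton_eq_iff)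
  qed
  have verts: "av ` IV = set us \<union> set vs" "bv ` IV = verts (C_graph s t)"
    by (auto simp: av_def bv_def IV_def C_graph_def image_Un image_image set_conv_nth len)
  have edges: "ae ` IE = {E u v | u v. u \<in> set us \<and> v \<in> set vs}" "be ` IE = edges (C_graph s t)"
    by (fastforce simp: ae_def be_def IE_def C_graph_def set_conv_nth len)+
  obtain \<phi> where \<phi>: "bij_betw \<phi> (av ` IV) (bv ` IV)" "\<And>x. x \<in> IV \<Longrightarrow> \<phi> (av x) = bv x"
    using bij_betw_match_parametrizations[OF inj_av inj_bv] by blast
  obtain \<psi> where \<psi>: "bij_betw \<psi> (ae ` IE) (be ` IE)" "\<And>x. x \<in> IE \<Longrightarrow> \<psi> (ae x) = be x"
    using bij_betw_match_parametrizations[OF inj_ae inj_be] by blast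
  have incidence: "av x \<in> arc_ends (ae y) \<longleftrightarrow> bv x \<in> arc_ends (be y)" if "x \<in> IV" "y \<in> IE" for x y
    using that by (cases y) (auto simp: ends_a ends_b IV_def IE_def av_def bv_def ueq veq uv uv[symmetric])
  have cross: "crosses (ae x) (ae y) \<longleftrightarrow> crosses (be x) (be y)" if xy: "x \<in> IE" "y \<in> IE" for x y
  proof -
    obtain i j i' j' where ij: "x = (i, j)" "y = (i', j')" "i < s" "i' < s" "j < t" "j' < t"
      using xy by (auto simp: IE_def)
    have a: "crosses (ae x) (ae y) \<longleftrightarrow> i \<noteq> i' \<and> j \<noteq> j' \<and> E (us ! i) (vs ! j) \<inter> E (us ! i') (vs ! j') \<noteq> {}"
      using ij by (simp add: ae_def crosses_edge_iff uU vV ueq veq)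
    have b: "crosses (be x) (be y) \<longleftrightarrow> i < i' \<and> j' < j \<or> i' < i \<and> j < j'"
      by (auto simp: ij be_def crosses_strip_segments_iff mult_less_0_iff)
    consider "i = i' \<or> j = j'" | "i < i' \<and> j' < j \<or> i' < i \<and> j < j'"
      | "i < i' \<and> j < j' \<or> i' < i \<and> j' < j" by linarith
    then show ?thesis
    proof cases
      case 1
      then show ?thesis unfolding a b by auto
    next
      case 2
      then have "E (us ! i) (vs ! j) \<inter> E (us ! i') (vs ! j') \<noteq> {}"
        using X[of i i' j' j] X[of i' i j j'] ij by (auto simp: Int_commute)
      then show ?thesis unfolding a b using 2 by auto
    next
      case 3
      then have "E (us ! i) (vs ! j') \<inter> E (us ! i') (vs ! j) \<noteq> {}"
        using X[of i i' j j'] X[of i' i j' j] ij by (auto simp: Int_commute)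
      then have "E (us ! i) (vs ! j) \<inter> E (us ! i') (vs ! j') = {}"
        using four_cycle_one_crossing[of "us ! i" "us ! i'" "vs ! j'" "vs ! j"] 3 ij
        by (auto simp: uU vV ueq veq)
      then show ?thesis unfolding a b using 3 by auto
    qed
  qed
  show ?thesis
    unfolding weakly_isomorphic_def
    using \<phi> \<psi> incidence cross
    by (intro exI[of _ \<phi>] exI[of _ \<psi>]) (auto simp: verts[symmetric] edges[symmetric])
qed

end

theorem theorem1p1:
  fixes k :: nat and G :: tgraph and U V :: "complex set"
  assumes "k \<ge> 1"
    and "complete_bipartite_simple_tgraph G U V"
    and "card U > 2 * (k - 1) ^ 4"
    and "card V \<ge> 2 ^ (k ^ (5 * k))"
  shows "\<exists>H. topological_subgraph H G \<and> weakly_isomorphic H (C_graph k k)"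
proof -
  obtain E where "bipartite_drawing U V E" and edges: "\<And>u v. \<lbrakk>u \<in> U; v \<in> V\<rbrakk> \<Longrightarrow> E u v \<in> edges G"
    using complete_bipartite_simple_tgraph_drawing[OF assms(2)] by blast
  then interpret bipartite_drawing U V E by simp
  obtain us vs where lists: "length us = k" "length vs = k" "distinct us" "distinct vs"
      "set us \<subseteq> U" "set vs \<subseteq> V"
    and cross: "\<And>i i' j j'. \<lbrakk>i < i'; i' < k; j < j'; j' < k\<rbrakk> \<Longrightarrow>
      E (us ! i) (vs ! j') \<inter> E (us ! i') (vs ! j) \<noteq> {}"
    using ordered_crossing_lists[OF assms(1,3,4)] by blast
  define H where "H = \<lparr>verts = set us \<union> set vs, edges = {E u v | u v. u \<in> set us \<and> v \<in> set vs}\<rparr>"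
  have "verts G = U \<union> V" using assms(2) by (simp add: complete_bipartite_simple_tgraph_def)
  then have "verts H \<subseteq> verts G" using lists(5,6) by (auto simp: H_def)
  moreover have "edges H \<subseteq> edges G" using edges lists(5,6) by (auto simp: H_def)
  moreover have "topological_graph H"
    unfolding H_def using lists(5,6) by (intro topological_graph_of_vertex_subsets) auto
  ultimately have "topological_subgraph H G" by (simp add: topological_subgraph_def)
  moreover have "weakly_isomorphic H (C_graph k k)"
    unfolding H_def by (rule ordered_crossings_weakly_isomorphic[OF lists cross])
  ultimately show ?thesis by blast
qed

end
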